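(* Let $\Delta t>0$ and $x\in H$. If the resolvent family satisfies $S(\cdot)x\in L^p((0,\infty);H)$ for some $1\le p\le\infty$, then for $1\le p<\infty$ and every $n\ge1$, $$\Delta t\sum_{k=1}^n\|B_kx\|^p\le\int_0^\infty\|S(t)x\|^p\,dt,$$ and for $p=\infty$, $$\sup_{k\ge1}\|B_kx\|\le\|S(\cdot)x\|_{L^\infty(\mathbb{R}_+)}.$$
   Context: $H$ real separable Hilbert space with norm $\|\cdot\|$; $A$ densely defined, positive, self-adjoint, unbounded, with compact inverse, orthonormal eigenbasis $\{e_k\}$, eigenvalues $0<\lambda_1\le\lambda_2\le\dots\to\infty$. $b$ satisfies Assumption 1: $0\ne b\in L^1_{loc}(\mathbb{R}_+)$ real valued, $b$ and $-\dot b$ nonnegative, nonincreasing and convex, $\lim_{t\to\infty}b(t)=0$, and $1+\frac2\pi\sup\{|\arg\widehat b(\lambda)|:\mathrm{Re}\,\lambda>0\}\in(1,2)$, $\widehat b$ the Laplace transform of $b$. Resolvent family of $\dot u+\int_0^tb(t-s)Au(s)ds=f$: $s_k$ solves $\dot s_k(t)+\lambda_k\int_0^tb(t-s)s_k(s)ds=0$, $s_k(0)=1$, and $S(t)v=\sum_ks_k(t)(v,e_k)e_k$. Quadrature weights: $\sum_{k\ge0}\omega_kz^k=\widehat b((1-z)/\Delta t)$ for $|z|<1$. Operators $B_k$: for $x\in H$ let $v_0=x$ and for $m\ge1$ let $v_m$ solve $v_m-v_{m-1}+\Delta t\sum_{k=1}^m\omega_{m-k}Av_k=0$; then $B_mx:=v_m$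 (so $B_0=I$). Equivalently $\sum_{k\ge0}B_kz^k=(I+\Delta t\,\widehat\omega(z)A)((1-z)I+\Delta t\,\widehat\omega(z)A)^{-1}$ with $\widehat\omega(z)=\sum_k\omega_kz^k$. *)

theory Defs
  imports "HOL-Analysis.Analysis" "HOL-Probability.Essential_Supremum"
begin

definition laplace :: "(real \<Rightarrow> real) \<Rightarrow> complex \<Rightarrow> complex" where
  "laplace b z = (LINT t:{0<..}|lborel. exp (- z * complex_of_real t) * complex_of_real (b t))"

text \<open>The operator A given by its orthonormal eigenbasis e and eigenvalues lam:
  domain and action.\<close>
definition domA :: "(nat \<Rightarrow> 'a::{real_inner,complete_space}) \<Rightarrow> (nat \<Rightarrow> real) \<Rightarrow> 'a set" where
  "domA e lam = {v. summable (\<lambda>k. (lam k * (v \<bullet> e k))^2)}"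

definition opA :: "(nat \<Rightarrow> 'a::{real_inner,complete_space}) \<Rightarrow> (nat \<Rightarrow> real) \<Rightarrow> 'a \<Rightarrow> 'a" where
  "opA e lam v = (\<Sum>k. (lam k * (v \<bullet> e k)) *\<^sub>R e k)"

definition Sop :: "(nat \<Rightarrow> 'a::{real_inner,complete_space}) \<Rightarrow> (nat \<Rightarrow> real \<Rightarrow> real) \<Rightarrow> real \<Rightarrow> 'a \<Rightarrow> 'a" where
  "Sop e s t v = (\<Sum>k. (s k t * (v \<bullet> e k)) *\<^sub>R e k)"

definition Bop :: "(nat \<Rightarrow> 'a::{real_inner,complete_space}) \<Rightarrow> (nat \<Rightarrow> real) \<Rightarrow> (nat \<Rightarrow> real)
    \<Rightarrow> real \<Rightarrow> nat \<Rightarrow> 'a \<Rightarrow> 'a" where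
  "Bop e lam w dt m x =
     (THE v. v 0 = x \<and>
        (\<forall>j\<ge>1. v j \<in> domA e lam \<and>
           v j - v (j - 1) + dt *\<^sub>R (\<Sum>k=1..j. w (j - k) *\<^sub>R opA e lam (v k)) = 0)) m"

end

theory Submission
  imports Defs "HOL-Probability.Distributions"
begin

text \<open>Substituting the generating function of the weights into the resolvent equation gives
  \<open>\<Sum>\<^sub>m B\<^bsub>m+1\<^esub> z\<^sup>m = \<Delta>t\<^sup>-\<^sup>1 \<Sigma>((1 - z)/\<Delta>t)\<close>, where \<open>\<Sigma>(r) = (r + b^(r) A)\<^sup>-\<^sup>1\<close> is the Laplace transform of
  \<open>S\<close>. Expanding \<open>exp (- (1 - z) t/\<Delta>t)\<close> in powers of \<open>z\<close> shows that \<open>B\<^sub>m x = \<integral> p\<^sub>m(t) S(t)x dt\<close> with the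
  Gamma (Erlang) density \<open>p\<^sub>m\<close>. The theorem is then Jensen's inequality together with
  \<open>\<Delta>t (p\<^sub>1 + \<dots> + p\<^sub>n) \<le> 1\<close>. The Laplace transforms converge, and \<open>S(t)x\<close> is well defined, because
  \<open>\<bar>s\<^sub>k\<bar> \<le> 1\<close>: a nonnegative, nonincreasing, convex kernel is of positive type, so testing the equation
  with \<open>s\<^sub>k\<close> gives \<open>s\<^sub>k(t)\<^sup>2 \<le> 1\<close>. Real Laplace variables suffice throughout.\<close>

section \<open>Convex kernels are of positive type\<close>

text \<open>A primitive on the whole line has two-sided derivatives everywhere, also at shifted
  times \<open>t - \<xi>\<close> that may be negative.\<close>

lemma antiderivative_real:
  fixes f :: "real \<Rightarrow> real"
  assumes "continuous_on UNIV f"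
  obtains F where "\<And>t. (F has_real_derivative f t) (at t)"
proof -
  have "\<exists>F. \<forall>x::real. -\<infinity> < ereal x \<longrightarrow> ereal x < \<infinity> \<longrightarrow> (F has_vector_derivative f x) (at x)"
    by (rule einterval_antiderivative) (use assms in \<open>auto simp: continuous_on_eq_continuous_at\<close>)
  then show thesis
    using that by (auto simp: has_real_derivative_iff_has_vector_derivative)
qed

text \<open>With \<open>S\<close> the primitive of \<open>s\<close>, extended by \<open>0\<close> to negative times, the inner integral times \<open>s\<close> equals
  \<open>E'(t) + (S(t) - S(t - \<xi>))\<^sup>2/2\<close> for the energy \<open>E(t) = \<integral>\<^bsub>t-\<xi>\<^esub>\<^bsup>t\<^esup> (S(t) - S(v))\<^sup>2 dv / 2\<close>.\<close>

lemma triangle_kernel_nonneg: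
  fixes s :: "real \<Rightarrow> real"
  assumes s: "continuous_on {0..} s" and T: "0 \<le> T" and xi: "0 \<le> \<xi>"
  shows "\<exists>J\<ge>0. ((\<lambda>t. s t * integral {0..t} (\<lambda>u. max 0 (\<xi> - (t - u)) * s u)) has_integral J) {0..T}"
proof -
  \<comment> \<open>Freezing \<open>s\<close> at its value \<open>s 0\<close> for negative times
    gives a continuous function on the line, hence a global primitive.\<close>
  have "continuous_on UNIV (\<lambda>t. s (max 0 t))"
    by (rule continuous_on_compose2[OF s]) (auto intro!: continuous_intros)
  then obtain F where F: "\<And>t. (F has_real_derivative s (max 0 t)) (at t)"
    by (rule antiderivative_real) blast
  \<comment> \<open>\<open>S\<close> vanishes for \<open>t \<le> 0\<close>, so it may have a corner
    at \<open>0\<close>; derivatives are taken only for \<open>t > 0\<close>, and the fundamental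
    theorem is used in its interior form.\<close>
  define S where "S t = F (max 0 t) - F 0" for t
  have contF: "continuous_on A F" for A
    by (meson F DERIV_isCont continuous_at_imp_continuous_on)
  have contS: "continuous_on A S" for A
    unfolding S_def by (intro continuous_intros continuous_on_compose2[OF contF[of UNIV]]) auto
  have S0: "S t = 0" if "t \<le> 0" for t
    using that by (simp add: S_def)
  have dS: "(S has_real_derivative s t) (at t)" if "t > 0" for t
  proof -
    have "((\<lambda>t. F t - F 0) has_real_derivative s t) (at t)"
      using F[of t] that by (auto intro!: derivative_eq_intros)
    then show ?thesis
      by (rule has_field_derivative_transform_within_open[where S="{0<..}"])
         (use that in \<open>auto simp: S_def\<close>)
  qed
  \<comment> \<open>With primitives of \<open>S\<close> and of its square, integrals over the moving
    window from \<open>t - \<xi>\<close> to \<open>t\<close> become differences that the chain rule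
    can differentiate.\<close>
  obtain W where W: "\<And>t. (W has_real_derivative S t) (at t)"
    by (rule antiderivative_real[OF contS]) blast
  obtain V where V: "\<And>t. (V has_real_derivative (S t)\<^sup>2) (at t)"
    by (rule antiderivative_real[of "\<lambda>t. (S t)\<^sup>2"]) (auto intro!: continuous_intros contS)
  have contW: "continuous_on A W" and contV: "continuous_on A V" for A
    by (meson W V DERIV_isCont continuous_at_imp_continuous_on)+
  have W0: "W t = W 0" if "t \<le> 0" for t
  proof (cases "t = 0")
    case False
    have "(W has_real_derivative 0) (at u)" if "u < 0" for u
      using W[of u] S0[of u] that by simp
    then have "W 0 = W t"
      by (intro DERIV_isconst_end contW) (use that False in auto)
    then show ?thesis by simp
  qed auto
  \<comment> \<open>This is the inner integral after integration by parts: the triangle takes the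
    value \<open>\<xi>\<close> at \<open>u = t\<close>, has slope 1 on the window, and
    \<open>S 0 = 0\<close>.\<close>
  define y where "y t = \<xi> * S t - (W t - W (t - \<xi>))" for t
  have conty: "continuous_on A y" for A
    unfolding y_def by (intro continuous_intros contS contW continuous_on_compose2[OF contW[of UNIV]]) auto
  have y: "integral {0..t} (\<lambda>u. max 0 (\<xi> - (t - u)) * s u) = y t" if t: "0 \<le> t" for t
  proof -
    \<comment> \<open>One continuous primitive for both pieces: to the left of
      \<open>t - \<xi>\<close> both terms are constant, and the kink at \<open>t - \<xi>\<close> is
      the single exceptional point.\<close>
    define H where "H u = max 0 (\<xi> - (t - u)) * S u - W (max u (t - \<xi>))" for u
    have "((\<lambda>u. max 0 (\<xi> - (t - u)) * s u) has_integral (H t - H 0)) {0..t}"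
    proof (rule fundamental_theorem_of_calculus_interior_strong[where S="{t - \<xi>}"])
      show "continuous_on {0..t} H"
        unfolding H_def
        by (intro continuous_intros contS contW continuous_on_compose2[OF contW[of UNIV]]) auto
      fix u assume u: "u \<in> {0<..<t} - {t - \<xi>}"
      show "(H has_vector_derivative max 0 (\<xi> - (t - u)) * s u) (at u)"
        unfolding has_real_derivative_iff_has_vector_derivative[symmetric]
      proof (cases "u < t - \<xi>")
        case True
        have "((\<lambda>u. - W (t - \<xi>)) has_real_derivative 0) (at u)" by simp
        then have "(H has_real_derivative 0) (at u)"
          by (rule has_field_derivative_transform_within_open[where S="{..<t - \<xi>}"])
             (use True in \<open>auto simp: H_def max_def\<close>)
        with True show "(H has_real_derivative max 0 (\<xi> - (t - u)) * s u) (at u)"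
          by (simp add: max_def)
      next
        case False
        have "((\<lambda>u. (\<xi> - (t - u)) * S u - W u) has_real_derivative (\<xi> - (t - u)) * s u) (at u)"
          using u by (auto intro!: derivative_eq_intros dS W)
        then have "(H has_real_derivative (\<xi> - (t - u)) * s u) (at u)"
          by (rule has_field_derivative_transform_within_open[where S="{t - \<xi><..}"])
             (use u False in \<open>auto simp: H_def max_def\<close>)
        with False u show "(H has_real_derivative max 0 (\<xi> - (t - u)) * s u) (at u)"
          by (simp add: max_def)
      qed
    qed (use t in auto)
    moreover have "H t - H 0 = y t"
      using xi S0[of 0] W0[of "t - \<xi>"] by (auto simp: H_def y_def max_def)
    ultimately show ?thesis by (simp add: integral_unique)
  qed
  \<comment> \<open>The energy with its square multiplied out, so that only values of
    \<open>S\<close>, \<open>W\<close> and \<open>V\<close> occur.\<close>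
  define E where "E t = (\<xi> * (S t)\<^sup>2 - 2 * S t * (W t - W (t - \<xi>)) + (V t - V (t - \<xi>))) / 2" for t
  have W': "((\<lambda>t. W (t - \<xi>)) has_real_derivative S (t - \<xi>)) (at t)" for t
    using DERIV_shift[of W "S (t - \<xi>)" t "-\<xi>"] W by simp
  have V': "((\<lambda>t. V (t - \<xi>)) has_real_derivative (S (t - \<xi>))\<^sup>2) (at t)" for t
    using DERIV_shift[of V "(S (t - \<xi>))\<^sup>2" t "-\<xi>"] V by simp
  have E: "((\<lambda>t. s t * y t - (S t - S (t - \<xi>))\<^sup>2 / 2) has_integral (E T - E 0)) {0..T}"
  proof (rule fundamental_theorem_of_calculus_interior)
    show "continuous_on {0..T} E"
      unfolding E_def by (intro continuous_intros contS contW contV continuous_on_compose2[OF contW[of UNIV]]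
        continuous_on_compose2[OF contV[of UNIV]]) auto
    fix t assume t: "t \<in> {0<..<T}"
    have "(E has_real_derivative s t * y t - (S t - S (t - \<xi>))\<^sup>2 / 2) (at t)"
      unfolding E_def using t
      by (auto intro!: derivative_eq_intros dS W V W' V' simp: y_def power2_eq_square field_simps)
    then show "(E has_vector_derivative s t * y t - (S t - S (t - \<xi>))\<^sup>2 / 2) (at t)"
      by (simp add: has_real_derivative_iff_has_vector_derivative)
  qed (use T in auto)
  \<comment> \<open>At time \<open>0\<close> the window lies in the negative half line, where
    \<open>S\<close> vanishes and \<open>V\<close> is constant.\<close>
  have "E 0 \<le> 0"
  proof -
    have "V (-\<xi>) = V 0"
    proof (cases "\<xi> = 0")
      case False
      have "(V has_real_derivative 0) (at u)" if "u < 0" for u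
        using V[of u] S0[of u] that by simp
      then have "V 0 = V (-\<xi>)"
        by (intro DERIV_isconst_end contV) (use xi False in auto)
      then show ?thesis by simp
    qed auto
    then show ?thesis using S0[of 0] by (simp add: E_def)
  qed
  moreover have "E T \<ge> 0"
  proof -
    \<comment> \<open>With \<open>S T\<close> held fixed, \<open>2 * E T\<close> is the increment of
      \<open>?G\<close> over the window, and the derivative of \<open>?G\<close> is the square of
      \<open>S T - S v\<close>.\<close>
    let ?G = "\<lambda>v. (S T)\<^sup>2 * v - 2 * S T * W v + V v"
    have "?G (T - \<xi>) \<le> ?G T"
    proof (rule DERIV_nonneg_imp_nondecreasing[where f = ?G])
      fix v
      have "(?G has_real_derivative (S T - S v)\<^sup>2) (at v)"
        by (auto intro!: derivative_eq_intros W V simp: power2_eq_square algebra_simps)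
      then show "\<exists>y. (?G has_real_derivative y) (at v) \<and> 0 \<le> y"
        by (meson zero_le_power2)
    qed (use xi in auto)
    then show ?thesis by (simp add: E_def algebra_simps)
  qed
  ultimately have EE: "E T - E 0 \<ge> 0" by simp
  have sy: "((\<lambda>t. s t * y t) has_integral integral {0..T} (\<lambda>t. s t * y t)) {0..T}"
    by (intro integrable_integral integrable_continuous_interval continuous_intros conty)
       (auto intro: continuous_on_subset[OF s])
  have "E T - E 0 \<le> integral {0..T} (\<lambda>t. s t * y t)"
    by (rule has_integral_le[OF E sy]) auto
  then have "0 \<le> integral {0..T} (\<lambda>t. s t * y t)" using EE by simp
  moreover have "((\<lambda>t. s t * integral {0..t} (\<lambda>u. max 0 (\<xi> - (t - u)) * s u)) has_integral
      integral {0..T} (\<lambda>t. s t * y t)) {0..T}"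
    by (rule has_integral_eq[OF _ sy]) (auto simp: y)
  ultimately show ?thesis by blast
qed

text \<open>The integrand is the derivative of half the squared primitive of \<open>s\<close>, which
  starts at \<open>0\<close>.\<close>

lemma constant_kernel_nonneg:
  fixes s :: "real \<Rightarrow> real"
  assumes s: "continuous_on {0..} s" and T: "0 \<le> T"
  shows "\<exists>J\<ge>0. ((\<lambda>t. s t * integral {0..t} s) has_integral J) {0..T}"
proof -
  define S where "S t = integral {0..t} s" for t
  have sT: "continuous_on {0..T} s" using s by (rule continuous_on_subset) auto
  have dS: "(S has_real_derivative s t) (at t within {0..T})" if "t \<in> {0..T}" for t
    using integral_has_real_derivative[OF sT that] unfolding S_def[abs_def] .
  have "((\<lambda>t. s t * S t) has_integral ((S T)\<^sup>2 / 2 - (S 0)\<^sup>2 / 2)) {0..T}"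
    by (rule fundamental_theorem_of_calculus[OF T])
       (auto simp: has_real_derivative_iff_has_vector_derivative[symmetric] intro!: derivative_eq_intros dS)
  moreover have "S 0 = 0" by (simp add: S_def)
  ultimately have "((\<lambda>t. s t * integral {0..t} s) has_integral (S T)\<^sup>2 / 2) {0..T}"
    by (simp add: S_def)
  then show ?thesis
    by (intro exI[of _ "(S T)\<^sup>2 / 2"]) simp
qed

text \<open>Nonnegativity of the quadratic form of the kernel, tested on the one function
  \<open>s\<close> and the one interval up to \<open>T\<close>. The integrability clause lets the
  inner integral split over sums of kernels; the witness \<open>J\<close> carries integrability and
  sign together.\<close>

definition positive_type :: "(real \<Rightarrow> real) \<Rightarrow> real \<Rightarrow> (real \<Rightarrow> real) \<Rightarrow> bool" where
  "positive_type s T \<beta> \<longleftrightarrow>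
     (\<forall>t\<in>{0..T}. (\<lambda>u. \<beta> (t - u) * s u) integrable_on {0..t}) \<and>
     (\<exists>J\<ge>0. ((\<lambda>t. s t * integral {0..t} (\<lambda>u. \<beta> (t - u) * s u)) has_integral J) {0..T})"

lemma positive_type_add:
  assumes f: "positive_type s T f" and g: "positive_type s T g"
  shows "positive_type s T (\<lambda>t. f t + g t)"
proof -
  let ?I = "\<lambda>f t. integral {0..t} (\<lambda>u. f (t - u) * s u)"
  have fi: "(\<lambda>u. f (t - u) * s u) integrable_on {0..t}" if "t \<in> {0..T}" for t
    using f that by (auto simp: positive_type_def)
  have gi: "(\<lambda>u. g (t - u) * s u) integrable_on {0..t}" if "t \<in> {0..T}" for t
    using g that by (auto simp: positive_type_def)
  obtain J K where J: "J \<ge> 0" "((\<lambda>t. s t * ?I f t) has_integral J) {0..T}"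
    and K: "K \<ge> 0" "((\<lambda>t. s t * ?I g t) has_integral K) {0..T}"
    using f g by (auto simp: positive_type_def)
  have "((\<lambda>t. s t * ?I f t + s t * ?I g t) has_integral J + K) {0..T}"
    by (intro has_integral_add J K)
  then have "((\<lambda>t. s t * ?I (\<lambda>t. f t + g t) t) has_integral J + K) {0..T}"
    by (rule has_integral_eq[rotated])
       (use fi gi in \<open>auto simp: distrib_left distrib_right integral_add\<close>)
  then show ?thesis
    unfolding positive_type_def using fi gi J(1) K(1)
    by (auto simp: distrib_right intro!: integrable_add exI[of _ "J + K"])
qed

lemma positive_type_cmult:
  assumes f: "positive_type s T f" and c: "0 \<le> c"
  shows "positive_type s T (\<lambda>t. c * f t)"
proof -
  let ?I = "\<lambda>f t. integral {0..t} (\<lambda>u. f (t - u) * s u)"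
  have fi: "(\<lambda>u. f (t - u) * s u) integrable_on {0..t}" if "t \<in> {0..T}" for t
    using f that by (auto simp: positive_type_def)
  obtain J where J: "J \<ge> 0" "((\<lambda>t. s t * ?I f t) has_integral J) {0..T}"
    using f by (auto simp: positive_type_def)
  have "((\<lambda>t. c * (s t * ?I f t)) has_integral c * J) {0..T}"
    by (intro has_integral_mult_right J)
  then have "((\<lambda>t. s t * ?I (\<lambda>t. c * f t) t) has_integral c * J) {0..T}"
    by (simp add: mult.assoc mult.left_commute)
  then show ?thesis
    unfolding positive_type_def using integrable_on_mult_right[OF fi] c J(1)
    by (auto simp: mult.assoc intro!: exI[of _ "c * J"])
qed

lemma positive_type_sum:
  assumes "finite A" "\<And>i. i \<in> A \<Longrightarrow> positive_type s T (f i)"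
  shows "positive_type s T (\<lambda>t. \<Sum>i\<in>A. f i t)"
  using assms
proof (induction A rule: finite_induct)
  case empty
  have "((\<lambda>t::real. 0::real) has_integral 0) {0..T}" by simp
  then show ?case by (auto simp: positive_type_def)
qed (auto intro!: positive_type_add)

lemma positive_type_triangle:
  assumes s: "continuous_on {0..} s" and T: "0 \<le> T" and xi: "0 \<le> \<xi>"
  shows "positive_type s T (\<lambda>t. max 0 (\<xi> - t))"
  unfolding positive_type_def
  using triangle_kernel_nonneg[OF s T xi] continuous_on_subset[OF s]
  by (auto intro!: integrable_continuous_interval continuous_intros)

lemma positive_type_const:
  assumes s: "continuous_on {0..} s" and T: "0 \<le> T" and c: "0 \<le> c"
  shows "positive_type s T (\<lambda>t. c)"
proof -
  have "positive_type s T (\<lambda>t. 1)"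
    unfolding positive_type_def
    using constant_kernel_nonneg[OF s T] continuous_on_subset[OF s]
    by (auto intro!: integrable_continuous_interval continuous_intros)
  from positive_type_cmult[OF this c] show ?thesis by simp
qed

text \<open>Discrete Taylor formula expanded at the right end \<open>M\<close>: second differences
  weighted by truncated distances recover \<open>a i\<close> up to the tangent line at
  \<open>M\<close>. Terms with \<open>j \<le> i\<close> vanish, so induction can start at
  \<open>M = i\<close>.\<close>

lemma second_difference_sum:
  fixes a :: "nat \<Rightarrow> real"
  assumes "i \<le> M"
  shows "(\<Sum>j=1..M. (a (j - 1) - 2 * a j + a (j + 1)) * max 0 (real j - real i))
    = a i - a M - (real M - real i) * (a M - a (M + 1))"
  using assms
proof (induction M rule: dec_induct)
  case base
  have "(\<Sum>j=1..i. (a (j - 1) - 2 * a j + a (j + 1)) * max 0 (real j - real i)) = 0"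
    by (intro sum.neutral) auto
  then show ?case by simp
next
  case (step M)
  then show ?case by (simp add: algebra_simps max_def)
qed

section \<open>Approximation of a convex kernel by nonnegative sums of triangles\<close>

locale convex_kernel =
  fixes b :: "real \<Rightarrow> real"
  assumes L1loc: "\<And>T. 0 < T \<Longrightarrow> set_integrable lborel {0<..<T} b"
    and nonneg: "\<And>t. 0 < t \<Longrightarrow> 0 \<le> b t"
    and noninc: "\<And>t u. 0 < t \<Longrightarrow> t \<le> u \<Longrightarrow> b u \<le> b t"
    and convex: "convex_on {0<..} b"
begin

text \<open>On \<open>[0, M h]\<close> this is the piecewise linear interpolant of \<open>t \<mapsto> b (t + h)\<close> at the nodes \<open>j h\<close>;
  shifting by one node avoids the singularity of \<open>b\<close> at \<open>0\<close> and keeps the interpolant below \<open>b\<close>.\<close>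

definition interpolant :: "real \<Rightarrow> nat \<Rightarrow> real \<Rightarrow> real" where
  "interpolant h M t =
     b (real (M + 1) * h) + (b (real (M + 1) * h) - b (real (M + 2) * h)) / h * max 0 (real M * h - t)
     + (\<Sum>j=1..M. (b (real j * h) - 2 * b (real (j + 1) * h) + b (real (j + 2) * h)) / h * max 0 (real j * h - t))"

lemma second_difference_nonneg:
  assumes "0 < h" "1 \<le> j"
  shows "0 \<le> b (real j * h) - 2 * b (real (j + 1) * h) + b (real (j + 2) * h)"
proof -
  have "b ((1 - 1/2) *\<^sub>R (real j * h) + (1/2) *\<^sub>R (real (j + 2) * h))
      \<le> (1 - 1/2) * b (real j * h) + (1/2) * b (real (j + 2) * h)"
    by (rule convex_onD[OF convex]) (use assms in auto)
  moreover have "(1 - 1/2) *\<^sub>R (real j * h) + (1/2) *\<^sub>R (real (j + 2) * h) = real (j + 1) * h"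
    by (simp add: field_simps)
  ultimately show ?thesis by simp
qed

lemma first_difference_nonneg:
  assumes "0 < h"
  shows "0 \<le> b (real (M + 1) * h) - b (real (M + 2) * h)"
  using noninc[of "real (M + 1) * h" "real (M + 2) * h"] assms by simp

text \<open>The discrete Taylor formula for the sequence \<open>b ((j + 1) * h)\<close>; the
  constant and the slope term of \<open>interpolant\<close> restore the tangent line at
  \<open>M\<close>.\<close>

lemma interpolant_node:
  assumes h: "0 < h" and i: "i \<le> M"
  shows "interpolant h M (real i * h) = b (real (i + 1) * h)"
proof -
  have m: "max 0 (real j * h - real i * h) = h * max 0 (real j - real i)" for j
    using h by (auto simp: max_def algebra_simps)
  let ?a = "\<lambda>j. b (real (j + 1) * h)"
  have "(\<Sum>j=1..M. (b (real j * h) - 2 * b (real (j + 1) * h) + b (real (j + 2) * h)) / h * max 0 (real j * h - real i * h))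
    = (\<Sum>j=1..M. (?a (j - 1) - 2 * ?a j + ?a (j + 1)) * max 0 (real j - real i))"
    unfolding m using h by (intro sum.cong) (simp_all add: add_ac)
  also have "\<dots> = ?a i - ?a M - (real M - real i) * (?a M - ?a (M + 1))"
    by (rule second_difference_sum[OF i])
  finally have sum: "(\<Sum>j=1..M. (b (real j * h) - 2 * b (real (j + 1) * h) + b (real (j + 2) * h)) / h * max 0 (real j * h - real i * h))
    = ?a i - ?a M - (real M - real i) * (?a M - ?a (M + 1))" .
  have "(?a M - ?a (M + 1)) / h * max 0 (real M * h - real i * h) = (real M - real i) * (?a M - ?a (M + 1))"
    unfolding m using h i by simp
  then show ?thesis
    unfolding interpolant_def sum by (simp add: add_ac)
qed

text \<open>All coefficients are nonnegative, by convexity and monotonicity of \<open>b\<close>, and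
  every triangle is nonincreasing.\<close>

lemma interpolant_antimono:
  assumes h: "0 < h" and tu: "t \<le> u"
  shows "interpolant h M u \<le> interpolant h M t"
  unfolding interpolant_def
  by (intro add_mono order_refl mult_left_mono sum_mono divide_nonneg_pos
      second_difference_nonneg first_difference_nonneg h) (use tu in auto)

text \<open>For \<open>t\<close> between the nodes \<open>i * h\<close> and
  \<open>(i + 1) * h\<close>, monotonicity of the interpolant puts its value between the node values
  \<open>b ((i + 2) * h)\<close> and \<open>b ((i + 1) * h)\<close>; monotonicity of
  \<open>b\<close> then moves the arguments to \<open>t + 2 * h\<close> and
  \<open>t\<close>.\<close>

lemma interpolant_bounds:
  assumes h: "0 < h" and t: "0 < t" "t < real M * h"
  shows "b (t + 2 * h) \<le> interpolant h M t" "interpolant h M t \<le> b t"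
proof -
  define i where "i = nat \<lfloor>t / h\<rfloor>"
  have i: "real i \<le> t / h" "t / h < real i + 1"
    using h t by (auto simp: i_def)
  then have i1: "real i * h \<le> t" "t < real (i + 1) * h"
    using h by (auto simp: field_simps)
  have "real i * h < real M * h" using i1 t by simp
  then have iM: "i < M" using h by simp
  have "b (t + 2 * h) \<le> b (real (i + 2) * h)"
    by (rule noninc) (use i1 h in \<open>auto simp: algebra_simps intro: add_nonneg_pos\<close>)
  also have "\<dots> = interpolant h M (real (i + 1) * h)"
    using interpolant_node[OF h, of "i + 1" M] iM by (simp add: add_ac)
  also have "\<dots> \<le> interpolant h M t"
    by (rule interpolant_antimono[OF h]) (use i1 in simp)
  finally show "b (t + 2 * h) \<le> interpolant h M t" .
  have "interpolant h M t \<le> interpolant h M (real i * h)"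
    by (rule interpolant_antimono[OF h i1(1)])
  also have "\<dots> = b (real (i + 1) * h)"
    using interpolant_node[OF h, of i M] iM by simp
  also have "\<dots> \<le> b t"
    by (rule noninc) (use i1 t in auto)
  finally show "interpolant h M t \<le> b t" .
qed

lemma interpolant_positive_type:
  assumes s: "continuous_on {0..} s" and T: "0 \<le> T" and h: "0 < h"
  shows "positive_type s T (interpolant h M)"
  unfolding interpolant_def
  by (intro positive_type_add positive_type_cmult positive_type_sum positive_type_const[OF s T]
      positive_type_triangle[OF s T] divide_nonneg_pos second_difference_nonneg first_difference_nonneg
      nonneg h) (use h in auto)

lemma continuous_interpolant: "continuous_on A (interpolant h M)"
  unfolding interpolant_def by (intro continuous_intros)

lemma continuous_kernel: "continuous_on {0<..} b"
  by (rule convex_on_continuous[OF _ convex]) auto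

text \<open>The assumptions on \<open>b\<close> concern positive arguments; the zero extension is
  measurable on the line and fits convolutions over all of it.\<close>

definition b_ext :: "real \<Rightarrow> real" where "b_ext t = indicator {0<..} t * b t"

lemma b_ext_nonneg: "0 \<le> b_ext t"
  using nonneg[of t] by (auto simp: b_ext_def indicator_def)

lemma b_ext_measurable [measurable]: "b_ext \<in> borel_measurable borel"
  using borel_measurable_continuous_on_indicator[OF _ continuous_kernel] by (simp add: b_ext_def[abs_def])

lemma b_ext_integrable: "set_integrable lborel {0..T} b_ext"
proof -
  have "set_integrable lborel {0<..<max 1 T + 1} b" by (rule L1loc) auto
  then have "integrable lborel (\<lambda>t. indicator {0<..<max 1 T + 1} t * b t)"
    by (simp add: set_integrable_def)
  then show ?thesis
    unfolding set_integrable_def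
  proof (rule Bochner_Integration.integrable_bound)
    show "(\<lambda>t. indicator {0..T} t *\<^sub>R b_ext t) \<in> borel_measurable lborel" by measurable
  qed (auto simp: b_ext_def indicator_def)
qed

lemma integrable_b_ext_reflect: "integrable lborel (\<lambda>u. indicator {0..T} (t - u) * b_ext (t - u))"
  using lborel_integrable_real_affine[of "\<lambda>v. indicator {0..T} v * b_ext v" "-1" t] b_ext_integrable[of T]
  by (simp add: set_integrable_def)

text \<open>The integrands differ at most at the null point \<open>u = t\<close>, where the kernel
  is evaluated at \<open>0\<close>.\<close>

lemma kernel_conv_eq:
  "(LINT u:{0..t}|lborel. b (t - u) * s u) = (LINT u:{0..t}|lborel. b_ext (t - u) * s u)"
  unfolding set_lebesgue_integral_def
  by (rule integral_discrete_difference[where X="{t}"])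
     (auto simp: b_ext_def indicator_def)

text \<open>Positive type passes from the interpolants to \<open>b\<close> as the mesh shrinks, by
  dominated convergence twice: the inner integrals are dominated by a multiple of the reflected
  kernel, the outer ones by a constant.\<close>

lemma kernel_positive_type:
  assumes s: "continuous_on {0..} s" and T: "0 \<le> T"
  shows "\<exists>J\<ge>0. ((\<lambda>t. s t * (LINT u:{0..t}|lborel. b (t - u) * s u)) has_integral J) {0..T}"
proof -
  define h where "h n = 1 / (real n + 1)" for n
  \<comment> \<open>The grid length \<open>M n * h n\<close> is the same for every \<open>n\<close>
    and exceeds \<open>T\<close>.\<close>
  define M where "M n = nat \<lceil>T + 1\<rceil> * (n + 1)" for n
  have h: "0 < h n" for n by (simp add: h_def)
  have hM: "T < real (M n) * h n" for n
  proof -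
    have "real (M n) * h n = real (nat \<lceil>T + 1\<rceil>)"
      by (simp add: M_def h_def field_simps)
    then show ?thesis using T by linarith
  qed
  define \<beta> where "\<beta> n = interpolant (h n) (M n)" for n
  have \<beta>_bounds: "b (t + 2 * h n) \<le> \<beta> n t" "\<beta> n t \<le> b t" if "0 < t" "t \<le> T" for t n
    using interpolant_bounds[OF h[of n], of t "M n"] that hM[of n] by (auto simp: \<beta>_def)
  have \<beta>_nonneg: "0 \<le> \<beta> n t" if "0 < t" "t \<le> T" for t n
    using \<beta>_bounds(1)[OF that, of n] nonneg[of "t + 2 * h n"] that h[of n] by linarith
  have h0: "h \<longlonglongrightarrow> 0"
    unfolding h_def by real_asymp
  have \<beta>_lim: "(\<lambda>n. \<beta> n t) \<longlonglongrightarrow> b t" if t: "0 < t" "t \<le> T" for t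
  proof (rule tendsto_sandwich)
    have "isCont b t"
      using continuous_kernel t by (simp add: continuous_on_eq_continuous_at)
    moreover have "(\<lambda>n. t + 2 * h n) \<longlonglongrightarrow> t"
      using tendsto_add[OF tendsto_const tendsto_mult[OF tendsto_const h0], of t 2] by simp
    ultimately show "(\<lambda>n. b (t + 2 * h n)) \<longlonglongrightarrow> b t"
      by (rule isCont_tendsto_compose)
    show "(\<lambda>n. b t) \<longlonglongrightarrow> b t" by simp
  qed (use \<beta>_bounds[OF t] in auto)
  have "compact (s ` {0..T})"
    by (intro compact_continuous_image continuous_on_subset[OF s]) auto
  then obtain C0 where C0: "\<And>t. t \<in> {0..T} \<Longrightarrow> \<bar>s t\<bar> \<le> C0"
    using compact_imp_bounded bounded_iff by (metis (no_types, lifting) image_eqI real_norm_def)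
  define C where "C = max 0 C0"
  have C: "0 \<le> C" "\<And>t. t \<in> {0..T} \<Longrightarrow> \<bar>s t\<bar> \<le> C"
    using C0 by (auto simp: C_def le_max_iff_disj)
  define B where "B = (LINT t:{0..T}|lborel. b_ext t)"
  have B: "integrable lborel (\<lambda>u. indicator {0..T} (t - u) * b_ext (t - u))"
      "(LINT u|lborel. indicator {0..T} (t - u) * b_ext (t - u)) = B" for t
  proof -
    show "integrable lborel (\<lambda>u. indicator {0..T} (t - u) * b_ext (t - u))"
      by (rule integrable_b_ext_reflect)
    show "(LINT u|lborel. indicator {0..T} (t - u) * b_ext (t - u)) = B"
      using lborel_integral_real_affine[of "-1" "\<lambda>v. indicator {0..T} v * b_ext v" t]
      by (simp add: B_def set_lebesgue_integral_def)
  qed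
  let ?I = "\<lambda>n t. integral {0..t} (\<lambda>u. \<beta> n (t - u) * s u)"
  have cont: "continuous_on {0..t} (\<lambda>u. \<beta> n (t - u) * s u)" for n t
    unfolding \<beta>_def
    by (intro continuous_intros continuous_on_subset[OF s] continuous_on_compose2[OF continuous_interpolant[of UNIV]])
       auto
  have seti: "set_integrable lborel {0..t} (\<lambda>u. \<beta> n (t - u) * s u)" for n t
    by (rule borel_integrable_atLeastAtMost'[OF cont])
  have I: "?I n t = (LINT u|lborel. indicator {0..t} u * (\<beta> n (t - u) * s u))" for n t
    using set_borel_integral_eq_integral(2)[OF seti[of t n]] by (simp add: set_lebesgue_integral_def)
  have dom: "AE u in lborel. norm (indicator {0..t} u * (\<beta> n (t - u) * s u))
      \<le> C * (indicator {0..T} (t - u) * b_ext (t - u))" if t: "t \<in> {0..T}" for n t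
  proof -
    \<comment> \<open>At \<open>u = t\<close> the extended kernel is \<open>0\<close> and gives no
      bound for the interpolant; this one point is discarded.\<close>
    have "AE u in lborel. u \<noteq> t" by (rule AE_lborel_singleton)
    then show ?thesis
    proof eventually_elim
      case (elim u)
      show ?case
      proof (cases "u \<in> {0..t}")
        case True
        then have tu: "0 < t - u" "t - u \<le> T" using elim t by auto
        have "\<bar>\<beta> n (t - u)\<bar> * \<bar>s u\<bar> \<le> b (t - u) * C"
          by (intro mult_mono) (use \<beta>_bounds(2)[OF tu, of n] \<beta>_nonneg[OF tu, of n] C True t nonneg tu in auto)
        then show ?thesis using True tu by (simp add: b_ext_def abs_mult mult.commute)
      next
        case False
        then show ?thesis using C b_ext_nonneg by simp
      qed
    qed
  qed
  have sc: "(\<lambda>u. indicator {0..t} u * s u) \<in> borel_measurable lborel" for t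
    using borel_measurable_continuous_on_indicator[of "{0..t}" s] continuous_on_subset[OF s, of "{0..t}"]
    by simp
  have lim: "(\<lambda>n. ?I n t) \<longlonglongrightarrow> (LINT u:{0..t}|lborel. b (t - u) * s u)" if t: "t \<in> {0..T}" for t
    unfolding I kernel_conv_eq
    unfolding set_lebesgue_integral_def real_scaleR_def
  proof (rule integral_dominated_convergence)
    show "integrable lborel (\<lambda>u. C * (indicator {0..T} (t - u) * b_ext (t - u)))"
      using B(1) by simp
    show "AE u in lborel. norm (indicator {0..t} u * (\<beta> n (t - u) * s u))
        \<le> C * (indicator {0..T} (t - u) * b_ext (t - u))" for n
      by (rule dom[OF t])
    show "(\<lambda>u. indicator {0..t} u * (\<beta> n (t - u) * s u)) \<in> borel_measurable lborel" for n
      using seti[of t n] unfolding set_integrable_def by (simp add: borel_measurable_integrable)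
    have "(\<lambda>u. b_ext (t - u) * (indicator {0..t} u * s u)) \<in> borel_measurable lborel"
      by (rule borel_measurable_times[OF _ sc]) simp
    then show "(\<lambda>u. indicator {0..t} u * (b_ext (t - u) * s u)) \<in> borel_measurable lborel"
      by (simp add: mult.left_commute)
    have "AE u in lborel. u \<noteq> t" by (rule AE_lborel_singleton)
    then show "AE u in lborel. (\<lambda>n. indicator {0..t} u * (\<beta> n (t - u) * s u))
        \<longlonglongrightarrow> indicator {0..t} u * (b_ext (t - u) * s u)"
    proof eventually_elim
      case (elim u)
      show ?case
      proof (cases "u \<in> {0..t}")
        case True
        then have tu: "0 < t - u" "t - u \<le> T" using elim t by auto
        show ?thesis
          using True tu by (auto intro!: tendsto_intros \<beta>_lim simp: b_ext_def)
      qed simp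
    qed
  qed
  have Ib: "norm (?I n t) \<le> C * B" if t: "t \<in> {0..T}" for n t
  proof -
    have "norm (?I n t) \<le> (LINT u|lborel. norm (indicator {0..t} u * (\<beta> n (t - u) * s u)))"
      unfolding I by (rule integral_norm_bound)
    also have "\<dots> \<le> (LINT u|lborel. C * (indicator {0..T} (t - u) * b_ext (t - u)))"
    proof (rule integral_mono_AE[OF _ _ dom[OF t]])
      show "integrable lborel (\<lambda>u. norm (indicator {0..t} u * (\<beta> n (t - u) * s u)))"
        using seti[of t n] unfolding set_integrable_def by (intro integrable_norm) simp
    qed (use B in simp)
    also have "\<dots> = C * B" using B by simp
    finally show ?thesis .
  qed
  let ?g = "\<lambda>t. s t * (LINT u:{0..t}|lborel. b (t - u) * s u)"
  have pt: "\<exists>J\<ge>0. ((\<lambda>t. s t * ?I n t) has_integral J) {0..T}" for n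
    using interpolant_positive_type[OF s T h[of n], of "M n"] by (simp add: positive_type_def \<beta>_def)
  have *: "norm (s t * ?I n t) \<le> C * (C * B)" if "t \<in> {0..T}" for n t
    unfolding norm_mult by (intro mult_mono Ib) (use that C in auto)
  have fi: "(\<lambda>t. s t * ?I n t) integrable_on {0..T}" for n
    using pt[of n] by (auto simp: integrable_on_def)
  have flim: "(\<lambda>n. s t * ?I n t) \<longlonglongrightarrow> ?g t" if "t \<in> {0..T}" for t
    by (intro tendsto_mult tendsto_const lim that)
  note g = dominated_convergence[OF fi integrable_const_ivl * flim]
  have "0 \<le> integral {0..T} (\<lambda>t. s t * ?I n t)" for n
    using pt[of n] by (auto dest: integral_unique)
  then have "0 \<le> integral {0..T} ?g"
    by (intro LIMSEQ_le_const[OF g(2)]) auto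
  then show ?thesis using g(1) by (intro exI[of _ "integral {0..T} ?g"]) (auto simp: integrable_integral)
qed

end

section \<open>The scalar Volterra equation\<close>

text \<open>Fubini and translation invariance. With both factors weighted by the same exponential
  this becomes the product rule for Laplace transforms.\<close>

lemma convolution_integral:
  fixes f g :: "real \<Rightarrow> real"
  assumes f: "integrable lborel f" and g: "integrable lborel g"
  shows "integrable lborel (\<lambda>t. LINT u|lborel. f (t - u) * g u)"
    and "(LINT t|lborel. LINT u|lborel. f (t - u) * g u) = (LINT t|lborel. f t) * (LINT u|lborel. g u)"
proof -
  have [measurable]: "f \<in> borel_measurable borel" "g \<in> borel_measurable borel"
    using f g by auto
  have shift: "integrable lborel (\<lambda>t. f (t - u))" "(LINT t|lborel. f (t - u)) = (LINT t|lborel. f t)" for u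
    using lborel_integrable_real_affine[OF f, of 1 "-u"] lborel_integral_real_affine[of 1 f "-u"]
    by (simp_all add: add.commute[of "-u"])
  have shifta: "(LINT t|lborel. \<bar>f (t - u)\<bar>) = (LINT t|lborel. \<bar>f t\<bar>)" for u
    using lborel_integral_real_affine[of 1 "\<lambda>t. \<bar>f t\<bar>" "-u"] by (simp add: add.commute[of "-u"])
  have F: "integrable (lborel \<Otimes>\<^sub>M lborel) (\<lambda>(u, t). f (t - u) * g u)"
  proof (rule lborel_pair.Fubini_integrable)
    show "(\<lambda>(u, t). f (t - u) * g u) \<in> borel_measurable (lborel \<Otimes>\<^sub>M lborel)"
      by measurable
    show "integrable lborel (\<lambda>u. LINT t|lborel. norm (case (u, t) of (u, t) \<Rightarrow> f (t - u) * g u))"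
      using g by (simp add: abs_mult shifta)
    show "AE u in lborel. integrable lborel (\<lambda>t. case (u, t) of (u, t) \<Rightarrow> f (t - u) * g u)"
      using shift by simp
  qed
  from lborel_pair.integrable_snd[OF F]
  show "integrable lborel (\<lambda>t. LINT u|lborel. f (t - u) * g u)" .
  show "(LINT t|lborel. LINT u|lborel. f (t - u) * g u) = (LINT t|lborel. f t) * (LINT u|lborel. g u)"
    using lborel_pair.Fubini_integral[OF F] by (simp add: shift)
qed

section \<open>Erlang densities and coefficients of power series\<close>

lemma integral_erlang_density:
  assumes l: "0 < l"
  shows "integrable lborel (erlang_density k l)" "(LINT t|lborel. erlang_density k l t) = 1"
proof -
  have "(\<integral>\<^sup>+t. ennreal (erlang_density k l t) \<partial>lborel) = ennreal 1"
    using nn_integral_erlang_ith_moment[OF l, of k 0] by simp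
  then have "has_bochner_integral lborel (erlang_density k l) 1"
    by (intro has_bochner_integral_nn_integral) (use l in auto)
  then show "integrable lborel (erlang_density k l)" "(LINT t|lborel. erlang_density k l t) = 1"
    by (auto simp: has_bochner_integral_iff)
qed

lemma integrable_exp_neg:
  assumes "0 < r"
  shows "integrable lborel (\<lambda>t. indicator {0..} t * exp (- r * t) :: real)"
proof -
  have "(\<lambda>t. indicator {0..} t * exp (- r * t)) = (\<lambda>t. erlang_density 0 r t / r)"
    using assms by (auto simp: erlang_density_def fun_eq_iff indicator_def)
  then show ?thesis using integral_erlang_density[OF assms, of 0] by simp
qed

lemma sums_erlang_density:
  assumes t: "0 \<le> t"
  shows "(\<lambda>j. z ^ j * erlang_density j l t) sums (l * exp (- ((1 - z) * l) * t))"
proof -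
  have "(\<lambda>j. (z * l * t) ^ j /\<^sub>R fact j) sums exp (z * l * t)"
    by (rule exp_converges)
  then have "(\<lambda>j. l * exp (- l * t) * ((z * l * t) ^ j /\<^sub>R fact j)) sums (l * exp (- l * t) * exp (z * l * t))"
    by (rule sums_mult)
  moreover have "l * exp (- l * t) * ((z * l * t) ^ j /\<^sub>R fact j) = z ^ j * erlang_density j l t" for j
    using t by (simp add: erlang_density_def power_mult_distrib field_simps)
  moreover have "l * exp (- l * t) * exp (z * l * t) = l * exp (- ((1 - z) * l) * t)"
    by (simp add: mult_exp_exp algebra_simps)
  ultimately show ?thesis by (simp only:)
qed

text \<open>Once the earlier coefficients vanish, the series may be divided by \<open>z ^ m\<close>;
  letting \<open>z\<close> tend to \<open>0\<close> isolates \<open>a m\<close>. This turns an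
  identity of generating functions into a recursion.\<close>

lemma power_series_zero_imp_coeff_zero:
  fixes a :: "nat \<Rightarrow> real"
  assumes "\<And>z. \<bar>z\<bar> < 1 \<Longrightarrow> (\<lambda>n. a n * z ^ n) sums 0"
  shows "a m = 0"
proof (induction m rule: less_induct)
  case (less m)
  have "(\<lambda>n. a (n + m) * z ^ n) sums 0" if z: "z \<noteq> 0" "\<bar>z\<bar> < 1" for z :: real
  proof -
    have "(\<lambda>n. a (n + m) * z ^ (n + m)) sums (0 - (\<Sum>n<m. a n * z ^ n))"
      using assms[OF z(2)] sums_iff_shift[of "\<lambda>n. a n * z ^ n" m] by simp
    then have "(\<lambda>n. a (n + m) * z ^ (n + m) / z ^ m) sums (0 / z ^ m)"
      using less by (intro sums_divide) simp
    then show ?thesis using z by (simp add: power_add)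
  qed
  then have "((\<lambda>z::real. 0::real) \<longlongrightarrow> a (0 + m)) (at 0)"
    using powser_limit_0_strong[of 1 "\<lambda>n. a (n + m)" "\<lambda>z::real. 0::real"] by simp
  then show ?case
    using tendsto_unique[OF trivial_limit_at tendsto_const] by fastforce
qed

section \<open>The Laplace transform of the kernel on the positive axis\<close>

context convex_kernel
begin

definition bhat :: "real \<Rightarrow> real" where "bhat r = (LINT t|lborel. exp (- r * t) * b_ext t)"

lemma integrable_exp_b_ext:
  assumes r: "0 < r"
  shows "integrable lborel (\<lambda>t. exp (- r * t) * b_ext t)"
proof (rule Bochner_Integration.integrable_bound)
  \<comment> \<open>Up to time 1 local integrability controls the singularity; beyond it
    \<open>b\<close> is at most \<open>b 1\<close> and the exponential gives the decay.\<close>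
  show "integrable lborel (\<lambda>t. indicator {0..1} t * b_ext t + b 1 * (indicator {0..} t * exp (- r * t)))"
    using b_ext_integrable[of 1] integrable_exp_neg[OF r] by (simp add: set_integrable_def)
  show "AE t in lborel. norm (exp (- r * t) * b_ext t)
      \<le> norm (indicator {0..1} t * b_ext t + b 1 * (indicator {0..} t * exp (- r * t)))"
  proof (rule AE_I2)
    fix t
    show "norm (exp (- r * t) * b_ext t) \<le> norm (indicator {0..1} t * b_ext t + b 1 * (indicator {0..} t * exp (- r * t)))"
    proof (cases "0 < t")
      case True
      have b1: "0 \<le> b 1" by (rule nonneg) simp
      show ?thesis
      proof (cases "t \<le> 1")
        case True
        have "exp (- r * t) * b t \<le> 1 * b t"
          using r \<open>0 < t\<close> nonneg by (intro mult_right_mono) auto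
        moreover have "0 \<le> b 1 * exp (- r * t)" using b1 by simp
        ultimately show ?thesis
          using True \<open>0 < t\<close> nonneg[of t] by (simp add: b_ext_def abs_mult)
      next
        case False
        have "exp (- r * t) * b t \<le> exp (- r * t) * b 1"
          using False noninc[of 1 t] by (intro mult_left_mono) auto
        then show ?thesis
          using False \<open>0 < t\<close> nonneg[of t] b1 by (simp add: b_ext_def abs_mult mult.commute)
      qed
    qed (simp add: b_ext_def)
  qed
qed measurable

lemma laplace_of_real: "laplace b (complex_of_real r) = complex_of_real (bhat r)"
proof -
  have "laplace b (complex_of_real r) = (LINT t|lborel. complex_of_real (exp (- r * t) * b_ext t))"
    unfolding laplace_def set_lebesgue_integral_def
  proof (rule Bochner_Integration.integral_cong[OF refl])
    fix t
    have "exp (- complex_of_real r * complex_of_real t) = complex_of_real (exp (- r * t))"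
      by (simp flip: exp_of_real)
    then show "indicator {0<..} t *\<^sub>R (exp (- complex_of_real r * complex_of_real t) * complex_of_real (b t))
        = complex_of_real (exp (- r * t) * b_ext t)"
      by (simp add: b_ext_def indicator_def)
  qed
  then show ?thesis
    by (simp only: integral_complex_of_real bhat_def)
qed

text \<open>As \<open>b\<close> is nonincreasing, the integrand on \<open>{0<..t0}\<close> is at
  least its positive value at \<open>t0\<close>. The positivity makes the leading weight
  \<open>w 0\<close> positive.\<close>

lemma bhat_pos:
  assumes r: "0 < r" and t0: "0 < t0" "b t0 \<noteq> 0"
  shows "0 < bhat r"
proof -
  let ?c = "exp (- r * t0) * b t0"
  have c: "0 < ?c" using nonneg[OF t0(1)] t0(2) by simp
  have I: "integrable lborel (\<lambda>t. indicator {0<..t0} t * ?c)"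
    by (intro integrable_mult_left integrable_real_indicator) (use t0 in auto)
  have "0 < t0 * ?c" using c t0 by simp
  also have "t0 * ?c = (LINT t|lborel. indicator {0<..t0} t * ?c)"
    using t0 by simp
  also have "\<dots> \<le> bhat r"
    unfolding bhat_def
  proof (rule integral_mono[OF I integrable_exp_b_ext[OF r]])
    fix t
    show "indicator {0<..t0} t * ?c \<le> exp (- r * t) * b_ext t"
    proof (cases "t \<in> {0<..t0}")
      case True
      have "?c \<le> exp (- r * t) * b t"
        using True r by (intro mult_mono noninc nonneg) auto
      then show ?thesis using True by (simp add: b_ext_def)
    qed (use b_ext_nonneg in auto)
  qed
  finally show ?thesis .
qed

end

section \<open>The scalar resolvent: uniform bound, Laplace transform, Erlang averages\<close>

locale scalar_volterra = convex_kernel +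
  fixes lam :: real and s :: "real \<Rightarrow> real"
  assumes lam_pos: "0 < lam"
    and s_cont: "continuous_on {0..} s"
    and s_init: "s 0 = 1"
    and s_eq: "\<And>t. 0 \<le> t \<Longrightarrow>
        (s has_real_derivative - (lam * (LINT u:{0..t}|lborel. b (t - u) * s u))) (at t within {0..})"
begin

abbreviation conv :: "real \<Rightarrow> real" where
  "conv t \<equiv> LINT u:{0..t}|lborel. b (t - u) * s u"

text \<open>The square of \<open>s\<close> changes over \<open>{0..T}\<close> by
  \<open>- 2 * lam\<close> times the quadratic form of the kernel, which is nonnegative.\<close>

lemma s_bounded:
  assumes T: "0 \<le> T"
  shows "\<bar>s T\<bar> \<le> 1"
proof -
  obtain J where J: "0 \<le> J" "((\<lambda>t. s t * conv t) has_integral J) {0..T}"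
    using kernel_positive_type[OF s_cont T] by blast
  have ds: "(s has_real_derivative - (lam * conv t)) (at t within {0..T})" if "t \<in> {0..T}" for t
    by (rule DERIV_subset[OF s_eq]) (use that in auto)
  have "((\<lambda>t. 2 * s t * - (lam * conv t)) has_integral ((s T)\<^sup>2 - (s 0)\<^sup>2)) {0..T}"
    by (rule fundamental_theorem_of_calculus[OF T])
       (auto simp: has_real_derivative_iff_has_vector_derivative[symmetric] intro!: derivative_eq_intros ds)
  moreover have "((\<lambda>t. - 2 * lam * (s t * conv t)) has_integral - 2 * lam * J) {0..T}"
    by (rule has_integral_mult_right[OF J(2)])
  ultimately have "(s T)\<^sup>2 - 1 = - 2 * lam * J"
    using s_init by (auto simp: algebra_simps dest: has_integral_unique)
  moreover have "0 \<le> lam * J"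
    using lam_pos J(1) by simp
  ultimately have "(s T)\<^sup>2 \<le> 1" by linarith
  then show ?thesis
    by (simp add: abs_square_le_1)
qed

definition s_ext :: "real \<Rightarrow> real" where "s_ext t = indicator {0..} t * s t"

lemma s_ext_bounded: "\<bar>s_ext t\<bar> \<le> 1"
  using s_bounded[of t] by (auto simp: s_ext_def indicator_def)

lemma s_ext_measurable [measurable]: "s_ext \<in> borel_measurable borel"
  using borel_measurable_continuous_on_indicator[OF _ s_cont] by (simp add: s_ext_def[abs_def])

definition shat :: "real \<Rightarrow> real" where "shat r = (LINT t|lborel. exp (- r * t) * s_ext t)"

lemma integrable_exp_s_ext:
  assumes r: "0 < r"
  shows "integrable lborel (\<lambda>t. exp (- r * t) * s_ext t)"
proof (rule Bochner_Integration.integrable_bound[OF integrable_exp_neg[OF r]])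
  show "AE t in lborel. norm (exp (- r * t) * s_ext t) \<le> norm (indicator {0..} t * exp (- r * t))"
    using s_bounded by (intro AE_I2) (auto simp: s_ext_def indicator_def abs_mult)
qed measurable

text \<open>The equation is multiplied by \<open>exp (- r * t)\<close> and integrated over
  \<open>{0..T}\<close>. As \<open>T\<close> grows, the boundary term dies out because
  \<open>s\<close> is bounded, and the convolution becomes the product of the transforms.\<close>

lemma laplace_identity:
  assumes r: "0 < r"
  shows "(r + lam * bhat r) * shat r = 1"
proof -
  let ?f = "\<lambda>t. exp (- r * t) * b_ext t" and ?g = "\<lambda>t. exp (- r * t) * s_ext t"
  let ?c = "\<lambda>t. LINT u|lborel. ?f (t - u) * ?g u"
  have swap: "x1 * x2 * (x3 * x4) = x1 * x3 * (x2 * x4)" for x1 x2 x3 x4 :: real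
    by simp
  have c: "?c t = exp (- r * t) * conv t" if "0 \<le> t" for t
  proof -
    have "?c t = (LINT u|lborel. exp (- r * t) * (indicator {0..t} u *\<^sub>R (b_ext (t - u) * s u)))"
    proof (rule Bochner_Integration.integral_cong[OF refl])
      fix u
      have "exp (- r * (t - u)) * exp (- r * u) = exp (- r * t)"
        by (simp add: mult_exp_exp algebra_simps)
      from swap[of "exp (- r * (t - u))" "b_ext (t - u)" "exp (- r * u)" "s_ext u", unfolded this]
      have *: "?f (t - u) * ?g u = exp (- r * t) * (b_ext (t - u) * s_ext u)" .
      show "?f (t - u) * ?g u = exp (- r * t) * (indicator {0..t} u *\<^sub>R (b_ext (t - u) * s u))"
        unfolding * by (auto simp: s_ext_def b_ext_def indicator_def)
    qed
    then show ?thesis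
      unfolding kernel_conv_eq unfolding set_lebesgue_integral_def by simp
  qed
  note conv = convolution_integral[OF integrable_exp_b_ext[OF r] integrable_exp_s_ext[OF r]]
  let ?k = "\<lambda>t. r * ?g t + lam * ?c t"
  have k: "integrable lborel ?k"
    using conv(1) integrable_exp_s_ext[OF r] by simp
  have ki: "integral\<^sup>L lborel ?k = r * shat r + lam * (bhat r * shat r)"
    using conv integrable_exp_s_ext[OF r] by (simp add: bhat_def shat_def)
  have k0: "?k t = 0" if "t < 0" for t
  proof -
    have "?c t = (LINT u|(lborel::real measure). 0)"
      by (rule Bochner_Integration.integral_cong) (use that in \<open>auto simp: b_ext_def s_ext_def indicator_def\<close>)
    then show ?thesis using that by (simp add: s_ext_def)
  qed
  \<comment> \<open>On nonnegative times \<open>- ?k\<close> is the derivative of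
    \<open>exp (- r * t) * s t\<close>.\<close>
  have kT: "(LINT t:{0..T}|lborel. ?k t) = 1 - exp (- r * T) * s T" if T: "0 \<le> T" for T
  proof -
    have "((\<lambda>t. - ?k t) has_integral (exp (- r * T) * s T - exp (- r * 0) * s 0)) {0..T}"
    proof (rule fundamental_theorem_of_calculus[OF T])
      fix t assume t: "t \<in> {0..T}"
      have "(s has_real_derivative - (lam * conv t)) (at t within {0..T})"
        by (rule DERIV_subset[OF s_eq]) (use t in auto)
      then have "((\<lambda>t. exp (- r * t) * s t) has_real_derivative
          (exp (- r * t) * (- r) * s t + exp (- r * t) * - (lam * conv t))) (at t within {0..T})"
        by (auto intro!: derivative_eq_intros)
      moreover have "exp (- r * t) * (- r) * s t + exp (- r * t) * - (lam * conv t) = - ?k t"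
      proof -
        have "?c t = exp (- r * t) * conv t" "s_ext t = s t" using t c by (auto simp: s_ext_def)
        then show ?thesis by (simp only:) (simp add: algebra_simps)
      qed
      ultimately show "((\<lambda>t. exp (- r * t) * s t) has_vector_derivative - ?k t) (at t within {0..T})"
        by (simp only: has_real_derivative_iff_has_vector_derivative)
    qed
    from has_integral_neg[OF this] have I: "(?k has_integral (1 - exp (- r * T) * s T)) {0..T}"
      unfolding s_init minus_minus by simp
    have "set_integrable lborel {0..T} ?k"
      unfolding set_integrable_def by (rule integrable_mult_indicator[OF _ k]) simp
    from set_borel_integral_eq_integral(2)[OF this] show ?thesis
      unfolding integral_unique[OF I] .
  qed
  have "((\<lambda>T. LINT t:{0..T}|lborel. ?k t) \<longlongrightarrow> (LINT t:{0..}|lborel. ?k t)) at_top"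
  proof (rule tendsto_set_lebesgue_integral_at_top)
    show "set_integrable lborel {0..} ?k"
      unfolding set_integrable_def by (rule integrable_mult_indicator[OF _ k]) simp
  qed simp
  moreover have "((\<lambda>T. LINT t:{0..T}|lborel. ?k t) \<longlongrightarrow> 1) at_top"
  proof (rule Lim_transform_eventually)
    have "((\<lambda>T. exp (- r * T) * s T) \<longlongrightarrow> 0) at_top"
    proof (rule Lim_null_comparison)
      show "\<forall>\<^sub>F T in at_top. norm (exp (- r * T) * s T) \<le> exp (- r * T)"
        using eventually_ge_at_top[of 0]
        by eventually_elim (use s_bounded in \<open>auto simp: abs_mult\<close>)
      show "((\<lambda>T. exp (- r * T)) \<longlongrightarrow> 0) at_top"
        using r by real_asymp
    qed
    from tendsto_diff[OF tendsto_const this, of 1]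
    show "((\<lambda>T. 1 - exp (- r * T) * s T) \<longlongrightarrow> 1) at_top" by simp
    show "\<forall>\<^sub>F T in at_top. 1 - exp (- r * T) * s T = (LINT t:{0..T}|lborel. ?k t)"
      using eventually_ge_at_top[of 0] by eventually_elim (rule kT[symmetric])
  qed
  ultimately have "(LINT t:{0..}|lborel. ?k t) = 1"
    using tendsto_unique trivial_limit_at_top_linorder by blast
  moreover have "(LINT t:{0..}|lborel. ?k t) = integral\<^sup>L lborel ?k"
    unfolding set_lebesgue_integral_def
  proof (rule Bochner_Integration.integral_cong[OF refl])
    fix t show "indicator {0..} t *\<^sub>R ?k t = ?k t"
      using k0[of t] by (cases "t < 0") (auto simp: indicator_def)
  qed
  ultimately show ?thesis
    using ki by (simp add: algebra_simps)
qed

text \<open>The scalar counterpart of \<open>B\<^sub>m\<close>.\<close>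

definition gamma_avg :: "real \<Rightarrow> nat \<Rightarrow> real" where
  "gamma_avg dt m = (if m = 0 then 1 else LINT t|lborel. erlang_density (m - 1) (1 / dt) t * s_ext t)"

lemma integrable_erlang_s_ext:
  assumes "0 < l"
  shows "integrable lborel (\<lambda>t. erlang_density j l t * s_ext t)"
proof (rule Bochner_Integration.integrable_bound[OF integral_erlang_density(1)[OF assms, of j]])
  show "AE t in lborel. norm (erlang_density j l t * s_ext t) \<le> norm (erlang_density j l t)"
    using s_ext_bounded by (intro AE_I2) (auto simp: abs_mult mult_left_le)
qed measurable

lemma gamma_avg_bounded:
  assumes "0 < dt"
  shows "\<bar>gamma_avg dt m\<bar> \<le> 1"
proof (cases "m = 0")
  case False
  let ?e = "erlang_density (m - 1) (1 / dt)"
  have dt: "0 < 1 / dt" using assms by simp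
  have "norm (LINT t|lborel. ?e t * s_ext t) \<le> (LINT t|lborel. norm (?e t * s_ext t))"
    by (rule integral_norm_bound)
  also have "\<dots> \<le> (LINT t|lborel. ?e t)"
  proof (rule integral_mono)
    show "integrable lborel (\<lambda>t. norm (?e t * s_ext t))"
      by (rule integrable_norm[OF integrable_erlang_s_ext[OF dt]])
    show "integrable lborel ?e" by (rule integral_erlang_density(1)[OF dt])
    show "norm (?e t * s_ext t) \<le> ?e t" for t
      using s_ext_bounded[of t] erlang_density_nonneg[of "1 / dt" "m - 1" t] assms
      by (simp add: abs_mult mult_left_le)
  qed
  finally show ?thesis
    using False integral_erlang_density(2)[OF dt] by (simp add: gamma_avg_def)
qed (simp add: gamma_avg_def)

text \<open>Summation and integration are interchanged: the density has mass 1 and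
  \<open>s_ext\<close> is bounded by 1, so the term of index \<open>j\<close> has integral norm at
  most \<open>\<bar>z\<bar> ^ j\<close>. The index is shifted because the step \<open>Suc j\<close>
  uses the density of order \<open>j\<close>.\<close>

lemma gamma_avg_generating:
  assumes dt: "0 < dt" and z: "\<bar>z\<bar> < 1"
  shows "(\<lambda>j. gamma_avg dt (Suc j) * z ^ j) sums (shat ((1 - z) / dt) / dt)"
proof -
  let ?l = "1 / dt"
  let ?F = "\<lambda>j t. z ^ j * erlang_density j ?l t * s_ext t"
  have l: "0 < ?l" using dt by simp
  have sF: "(\<lambda>j. ?F j t) sums (?l * exp (- ((1 - z) * ?l) * t) * s_ext t)" for t
  proof (cases "0 \<le> t")
    case True
    then show ?thesis by (intro sums_mult2 sums_erlang_density)
  qed (simp add: s_ext_def)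
  have "(\<lambda>j. LINT t|lborel. ?F j t) sums (LINT t|lborel. (\<Sum>j. ?F j t))"
  proof (rule sums_integral)
    show "integrable lborel (?F j)" for j
      using integrable_erlang_s_ext[OF l, of j] by (simp add: mult.assoc)
    show "AE t in lborel. summable (\<lambda>j. norm (?F j t))"
    proof (rule AE_I2)
      fix t
      show "summable (\<lambda>j. norm (?F j t))"
      proof (cases "0 \<le> t")
        case True
        have "summable (\<lambda>j. \<bar>z\<bar> ^ j * erlang_density j ?l t * \<bar>s_ext t\<bar>)"
          using sums_erlang_density[OF True, of "\<bar>z\<bar>" ?l] by (intro summable_mult2) (simp add: sums_iff)
        moreover have "norm (?F j t) = \<bar>z\<bar> ^ j * erlang_density j ?l t * \<bar>s_ext t\<bar>" for j
          using erlang_density_nonneg[of ?l j t] l by (simp add: abs_mult power_abs)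
        ultimately show ?thesis by (simp only:)
      qed (simp add: s_ext_def)
    qed
    show "summable (\<lambda>j. LINT t|lborel. norm (?F j t))"
    proof (rule summable_comparison_test)
      show "summable (\<lambda>j. \<bar>z\<bar> ^ j)" using z by (simp add: summable_geometric)
      have "norm (LINT t|lborel. norm (?F j t)) \<le> \<bar>z\<bar> ^ j" for j
      proof -
        have "(LINT t|lborel. norm (?F j t)) \<le> (LINT t|lborel. \<bar>z\<bar> ^ j * erlang_density j ?l t)"
        proof (rule integral_mono)
          show "integrable lborel (\<lambda>t. norm (?F j t))"
            using integrable_erlang_s_ext[OF l, of j] by (intro integrable_norm) (simp add: mult.assoc)
          show "integrable lborel (\<lambda>t. \<bar>z\<bar> ^ j * erlang_density j ?l t)"
            using integral_erlang_density(1)[OF l, of j] by simp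
          show "norm (?F j t) \<le> \<bar>z\<bar> ^ j * erlang_density j ?l t" for t
            using s_ext_bounded[of t] erlang_density_nonneg[of ?l j t] l
            by (simp add: abs_mult power_abs mult_left_le)
        qed
        then show ?thesis
          using integral_erlang_density(2)[OF l, of j] by (simp add: integral_nonneg_AE)
      qed
      then show "\<exists>N. \<forall>n\<ge>N. norm (LINT t|lborel. norm (?F n t)) \<le> \<bar>z\<bar> ^ n" by blast
    qed
  qed
  moreover have "(\<Sum>j. ?F j t) = ?l * (exp (- ((1 - z) / dt) * t) * s_ext t)" for t
    using sF[of t] by (simp add: sums_iff)
  moreover have "(LINT t|lborel. ?F j t) = gamma_avg dt (Suc j) * z ^ j" for j
  proof -
    have "?F j = (\<lambda>t. z ^ j * (erlang_density j ?l t * s_ext t))" by (simp add: mult.assoc)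
    then show ?thesis by (simp add: gamma_avg_def)
  qed
  ultimately show ?thesis
    by (simp add: shat_def)
qed

text \<open>The coefficient of \<open>z ^ m\<close> in the Laplace identity at
  \<open>r = (1 - z) / dt\<close>.\<close>

lemma gamma_avg_recursion:
  assumes dt: "0 < dt"
    and w: "\<And>z. \<bar>z\<bar> < 1 \<Longrightarrow> (\<lambda>k. w k * z ^ k) sums bhat ((1 - z) / dt)"
  shows "gamma_avg dt (Suc m) - gamma_avg dt m + dt * lam * (\<Sum>i\<le>m. gamma_avg dt (Suc i) * w (m - i)) = 0"
proof (rule power_series_zero_imp_coeff_zero)
  fix z :: real assume z: "\<bar>z\<bar> < 1"
  let ?r = "(1 - z) / dt"
  let ?A = "shat ?r / dt"
  have r: "0 < ?r" using z dt by simp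
  have A: "(\<lambda>j. gamma_avg dt (Suc j) * z ^ j) sums ?A" by (rule gamma_avg_generating[OF dt z])
  have "(\<lambda>j. gamma_avg dt (Suc j) * z ^ Suc j) sums (?A * z)"
    using sums_mult2[OF A, of z] by (simp add: mult.assoc mult.commute)
  \<comment> \<open>The convention that \<open>gamma_avg\<close> is 1 at index \<open>0\<close>
    supplies the \<open>1\<close>, which cancels the right-hand side of the Laplace
    identity.\<close>
  then have C: "(\<lambda>j. gamma_avg dt j * z ^ j) sums (?A * z + 1)"
    using sums_Suc_iff[of "\<lambda>j. gamma_avg dt j * z ^ j"] by (simp add: gamma_avg_def)
  have "(\<lambda>m. \<Sum>i\<le>m. (gamma_avg dt (Suc i) * z ^ i) * (w (m - i) * z ^ (m - i))) sums
      ((\<Sum>j. gamma_avg dt (Suc j) * z ^ j) * (\<Sum>j. w j * z ^ j))"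
  proof (rule Cauchy_product_sums)
    \<comment> \<open>Convergence at the larger radius \<open>y\<close> yields the absolute
      convergence at \<open>z\<close> that the Cauchy product needs.\<close>
    obtain y where y: "\<bar>z\<bar> < y" "y < 1" using z dense by blast
    then have *: "summable (\<lambda>j. gamma_avg dt (Suc j) * y ^ j)" "summable (\<lambda>j. w j * y ^ j)" "norm z < norm y"
      using gamma_avg_generating[OF dt, of y] w[of y] by (auto simp: sums_iff)
    show "summable (\<lambda>j. norm (gamma_avg dt (Suc j) * z ^ j))" "summable (\<lambda>j. norm (w j * z ^ j))"
      by (rule powser_insidea[OF *(1,3)], rule powser_insidea[OF *(2,3)])
  qed
  moreover have "(\<Sum>i\<le>m. (gamma_avg dt (Suc i) * z ^ i) * (w (m - i) * z ^ (m - i)))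
      = (\<Sum>i\<le>m. gamma_avg dt (Suc i) * w (m - i)) * z ^ m" for m
    unfolding sum_distrib_right
  proof (rule sum.cong[OF refl])
    fix i assume "i \<in> {..m}"
    then have "z ^ m = z ^ i * z ^ (m - i)" by (simp flip: power_add)
    then show "gamma_avg dt (Suc i) * z ^ i * (w (m - i) * z ^ (m - i)) = gamma_avg dt (Suc i) * w (m - i) * z ^ m"
      by simp
  qed
  ultimately have P: "(\<lambda>m. (\<Sum>i\<le>m. gamma_avg dt (Suc i) * w (m - i)) * z ^ m) sums (?A * bhat ?r)"
    using A w[OF z] by (simp add: sums_iff)
  have "(\<lambda>m. gamma_avg dt (Suc m) * z ^ m - gamma_avg dt m * z ^ m + dt * lam * ((\<Sum>i\<le>m. gamma_avg dt (Suc i) * w (m - i)) * z ^ m))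
      sums (?A - (?A * z + 1) + dt * lam * (?A * bhat ?r))"
    by (intro sums_add sums_diff sums_mult A C P)
  moreover have "?A - (?A * z + 1) + dt * lam * (?A * bhat ?r) = (?r + lam * bhat ?r) * shat ?r - 1"
    using dt by (simp add: field_simps)
  ultimately show "(\<lambda>m. (gamma_avg dt (Suc m) - gamma_avg dt m + dt * lam * (\<Sum>i\<le>m. gamma_avg dt (Suc i) * w (m - i))) * z ^ m) sums 0"
    using laplace_identity[OF r] by (simp add: algebra_simps)
qed

end

section \<open>The implicit scheme in the eigenbasis\<close>

locale orthonormal_basis =
  fixes e :: "nat \<Rightarrow> 'a::{real_inner,complete_space}"
  assumes orthonormal: "\<And>i j. e i \<bullet> e j = (if i = j then 1 else 0)"
    and complete: "\<And>v. (\<lambda>n. \<Sum>k<n. (v \<bullet> e k) *\<^sub>R e k) \<longlonglongrightarrow> v"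
begin

lemma norm_sum_basis:
  assumes "finite A"
  shows "(norm (\<Sum>k\<in>A. c k *\<^sub>R e k))\<^sup>2 = (\<Sum>k\<in>A. (c k)\<^sup>2)"
  using assms
  unfolding power2_norm_eq_inner
  by (simp add: inner_sum_left inner_sum_right orthonormal power2_eq_square
      if_distrib[of "\<lambda>x. _ * x"] cong: if_cong)

lemma inner_sum_basis:
  assumes "finite A"
  shows "(\<Sum>k\<in>A. c k *\<^sub>R e k) \<bullet> e j = (if j \<in> A then c j else 0)"
  using assms
  by (simp add: inner_sum_left orthonormal if_distrib[of "\<lambda>x. _ * x"] cong: if_cong)

text \<open>By Pythagoras the blocks of the vector series have squared norm equal to blocks of the
  convergent scalar series; completeness of the space does the rest.\<close>

lemma summable_basis:
  assumes c: "summable (\<lambda>k. (c k)\<^sup>2)"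
  shows "summable (\<lambda>k. c k *\<^sub>R e k)"
proof -
  have "Cauchy (\<lambda>n. \<Sum>k<n. c k *\<^sub>R e k)"
  proof (rule CauchyI')
    fix r :: real assume r: "0 < r"
    then obtain N where N: "\<And>m n. N \<le> m \<Longrightarrow> norm (\<Sum>k=m..<n. (c k)\<^sup>2) < r\<^sup>2"
      using c unfolding summable_Cauchy by (metis zero_less_power)
    have "norm ((\<Sum>k<m. c k *\<^sub>R e k) - (\<Sum>k<n. c k *\<^sub>R e k)) < r" if "N \<le> m" "m < n" for m n
    proof -
      have "(\<Sum>k<n. c k *\<^sub>R e k) - (\<Sum>k<m. c k *\<^sub>R e k) = (\<Sum>k=m..<n. c k *\<^sub>R e k)"
        using sum_diff_nat_ivl[of 0 m n "\<lambda>k. c k *\<^sub>R e k"] that by (simp add: atLeast0LessThan)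
      moreover have "(norm (\<Sum>k=m..<n. c k *\<^sub>R e k))\<^sup>2 < r\<^sup>2"
        using N[OF that(1), of n] by (simp add: norm_sum_basis sum_nonneg)
      ultimately show ?thesis
        using r by (metis norm_minus_commute power_less_imp_less_base less_imp_le)
    qed
    then show "\<exists>M. \<forall>m\<ge>M. \<forall>n>m. dist (\<Sum>k<m. c k *\<^sub>R e k) (\<Sum>k<n. c k *\<^sub>R e k) < r"
      by (auto simp: dist_norm)
  qed
  then show ?thesis
    by (simp add: summable_iff_convergent Cauchy_convergent)
qed

lemma inner_suminf_basis:
  assumes c: "summable (\<lambda>k. (c k)\<^sup>2)"
  shows "(\<Sum>k. c k *\<^sub>R e k) \<bullet> e j = c j"
proof -
  have "(\<lambda>n. (\<Sum>k<n. c k *\<^sub>R e k) \<bullet> e j) \<longlonglongrightarrow> (\<Sum>k. c k *\<^sub>R e k) \<bullet> e j"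
    by (intro tendsto_intros summable_LIMSEQ summable_basis c)
  moreover have "(\<lambda>n. (\<Sum>k<n. c k *\<^sub>R e k) \<bullet> e j) \<longlonglongrightarrow> c j"
    by (rule tendsto_eventually, rule eventually_mono[OF eventually_gt_at_top[of j]])
       (simp add: inner_sum_basis)
  ultimately show ?thesis by (rule LIMSEQ_unique)
qed

lemma basis_eqI:
  assumes "\<And>k. u \<bullet> e k = v \<bullet> e k"
  shows "u = v"
  using complete[of u] complete[of v] assms by (simp add: LIMSEQ_unique)

lemma parseval: "(\<lambda>k. (v \<bullet> e k)\<^sup>2) sums (norm v)\<^sup>2"
proof -
  have "(\<lambda>n. (norm (\<Sum>k<n. (v \<bullet> e k) *\<^sub>R e k))\<^sup>2) \<longlonglongrightarrow> (norm v)\<^sup>2"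
    by (intro tendsto_intros complete)
  then show ?thesis by (simp add: norm_sum_basis sums_def)
qed

lemma summable_multiplier:
  assumes "\<And>k. \<bar>a k\<bar> \<le> K"
  shows "summable (\<lambda>k. (a k * (v \<bullet> e k))\<^sup>2)"
proof (rule summable_comparison_test)
  show "summable (\<lambda>k. K\<^sup>2 * (v \<bullet> e k)\<^sup>2)"
    using parseval[of v] by (intro summable_mult) (simp add: sums_iff)
  have "(a k)\<^sup>2 \<le> K\<^sup>2" for k
    using assms[of k] by (metis abs_ge_zero power2_abs power_mono)
  then show "\<exists>N. \<forall>k\<ge>N. norm ((a k * (v \<bullet> e k))\<^sup>2) \<le> K\<^sup>2 * (v \<bullet> e k)\<^sup>2"
    by (auto simp: power_mult_distrib intro!: mult_right_mono)
qed

text \<open>The norm inequality for a vector integral given through its coordinates. Pairing with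
  the partial expansion \<open>?P\<close> of \<open>y\<close> bounds
  \<open>norm ?P * norm ?P\<close> by \<open>norm ?P\<close> times the integral of
  \<open>\<psi>\<close>; after division the partial expansions converge to \<open>y\<close>.\<close>

lemma norm_le_integral:
  assumes F: "\<And>k. integrable M (\<lambda>t. F t \<bullet> e k)" and y: "\<And>k. y \<bullet> e k = (LINT t|M. F t \<bullet> e k)"
    and \<psi>: "integrable M \<psi>" and F\<psi>: "AE t in M. norm (F t) \<le> \<psi> t"
  shows "norm y \<le> (LINT t|M. \<psi> t)"
proof (rule Lim_bounded)
  show "(\<lambda>n. norm (\<Sum>k<n. (y \<bullet> e k) *\<^sub>R e k)) \<longlonglongrightarrow> norm y"
    by (intro tendsto_norm complete)
  have "0 \<le> (LINT t|M. \<psi> t)"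
    by (rule integral_nonneg_AE, rule eventually_mono[OF F\<psi>]) (use norm_ge_zero order_trans in blast)
  have "norm (\<Sum>k<n. (y \<bullet> e k) *\<^sub>R e k) \<le> (LINT t|M. \<psi> t)" for n
  proof -
    let ?P = "\<Sum>k<n. (y \<bullet> e k) *\<^sub>R e k"
    have "norm ?P * norm ?P = (\<Sum>k<n. (y \<bullet> e k) * (LINT t|M. F t \<bullet> e k))"
      using norm_sum_basis[of "{..<n}" "\<lambda>k. y \<bullet> e k"] by (simp add: power2_eq_square y)
    also have "\<dots> = (LINT t|M. (\<Sum>k<n. (y \<bullet> e k) * (F t \<bullet> e k)))"
      using F by simp
    also have "\<dots> \<le> (LINT t|M. norm ?P * \<psi> t)"
    proof (rule integral_mono_AE)
      show "AE t in M. (\<Sum>k<n. (y \<bullet> e k) * (F t \<bullet> e k)) \<le> norm ?P * \<psi> t"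
        using F\<psi>
      proof eventually_elim
        case (elim t)
        have "(\<Sum>k<n. (y \<bullet> e k) * (F t \<bullet> e k)) = ?P \<bullet> F t"
          by (simp add: inner_sum_left inner_commute[of "F t"])
        also have "\<dots> \<le> norm ?P * norm (F t)" by (rule norm_cauchy_schwarz)
        also have "\<dots> \<le> norm ?P * \<psi> t" using elim by (intro mult_left_mono) auto
        finally show ?case .
      qed
    qed (use F \<psi> in auto)
    also have "\<dots> = norm ?P * (LINT t|M. \<psi> t)" by simp
    finally show ?thesis
      using \<open>0 \<le> (LINT t|M. \<psi> t)\<close> by (cases "?P = 0") auto
  qed
  then show "\<forall>n\<ge>0. norm (\<Sum>k<n. (y \<bullet> e k) *\<^sub>R e k) \<le> (LINT t|M. \<psi> t)" by blast
qed

end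

section \<open>The scheme as a scalar recursion on each coordinate\<close>

locale implicit_scheme = orthonormal_basis e
  for e :: "nat \<Rightarrow> 'a::{real_inner,complete_space}" +
  fixes lam :: "nat \<Rightarrow> real" and w :: "nat \<Rightarrow> real" and dt :: real and C :: "nat \<Rightarrow> nat \<Rightarrow> real"
  assumes dt: "0 < dt" and lam: "\<And>k. 0 < lam k" and w0: "0 < w 0"
    and C0: "\<And>k. C k 0 = 1" and Cb: "\<And>k m. \<bar>C k m\<bar> \<le> 1"
    and C: "\<And>k m. C k (Suc m) - C k m + dt * lam k * (\<Sum>i\<le>m. C k (Suc i) * w (m - i)) = 0"
begin

text \<open>The recursion is solved for its newest term, whose factor \<open>dt * w 0\<close> is
  positive and independent of \<open>k\<close>. The bound, uniform in \<open>k\<close>, places the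
  iterates in the domain of the operator although \<open>lam\<close> may be unbounded.\<close>

lemma lam_C_bounded: "\<exists>K. \<forall>k. \<bar>lam k * C k (Suc n)\<bar> \<le> K"
proof (induction n rule: less_induct)
  case (less n)
  then obtain K where K: "\<And>i k. i < n \<Longrightarrow> \<bar>lam k * C k (Suc i)\<bar> \<le> K i"
    by metis
  \<comment> \<open>The \<open>2\<close> bounds \<open>C k n - C k (Suc n)\<close>; the sum bounds
    the memory terms by induction.\<close>
  define L where "L = (2 + dt * (\<Sum>i<n. K i * \<bar>w (n - i)\<bar>)) / (dt * w 0)"
  have "\<bar>lam k * C k (Suc n)\<bar> \<le> L" for k
  proof -
    let ?S = "\<Sum>i<n. (lam k * C k (Suc i)) * w (n - i)"
    have "(\<Sum>i\<le>n. C k (Suc i) * w (n - i)) = (\<Sum>i<n. C k (Suc i) * w (n - i)) + C k (Suc n) * w 0"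
      by (simp add: lessThan_Suc_atMost[symmetric])
    with C[of k n] have "dt * w 0 * (lam k * C k (Suc n)) = C k n - C k (Suc n) - dt * ?S"
      by (simp add: algebra_simps sum_distrib_left)
    moreover have "\<bar>dt * ?S\<bar> \<le> dt * (\<Sum>i<n. K i * \<bar>w (n - i)\<bar>)"
    proof -
      have "\<bar>?S\<bar> \<le> (\<Sum>i<n. K i * \<bar>w (n - i)\<bar>)"
        by (rule order_trans[OF sum_abs], rule sum_mono) (simp add: abs_mult[of _ "w _"] K mult_right_mono)
      then show ?thesis using dt by (simp add: abs_mult[of dt])
    qed
    ultimately have "\<bar>dt * w 0 * (lam k * C k (Suc n))\<bar> \<le> 2 + dt * (\<Sum>i<n. K i * \<bar>w (n - i)\<bar>)"
      using Cb[of k n] Cb[of k "Suc n"] unfolding abs_le_iff by linarith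
    moreover have "\<bar>dt * w 0 * (lam k * C k (Suc n))\<bar> = \<bar>lam k * C k (Suc n)\<bar> * (dt * w 0)"
      using dt w0 by (simp add: abs_mult)
    ultimately show ?thesis
      using dt w0 by (simp add: L_def pos_le_divide_eq)
  qed
  then show ?case by blast
qed

lemma shift_sum:
  fixes f :: "nat \<Rightarrow> 'b::real_vector"
  shows "(\<Sum>k=1..Suc n. w (Suc n - k) *\<^sub>R f k) = (\<Sum>i\<le>n. w (n - i) *\<^sub>R f (Suc i))"
  unfolding One_nat_def sum.shift_bounds_cl_Suc_ivl by (simp add: atLeast0AtMost)

lemma opA_inner:
  assumes "v \<in> domA e lam"
  shows "opA e lam v \<bullet> e k = lam k * (v \<bullet> e k)"
  using assms unfolding opA_def domA_def by (auto intro: inner_suminf_basis)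

text \<open>The vectors with multipliers \<open>C k m\<close> solve the scheme, and the solution is
  unique, so the definite description selects them.\<close>

lemma Bop_inner: "Bop e lam w dt m x \<bullet> e k = C k m * (x \<bullet> e k)"
proof -
  let ?P = "\<lambda>v. v 0 = x \<and> (\<forall>j\<ge>1. v j \<in> domA e lam \<and>
           v j - v (j - 1) + dt *\<^sub>R (\<Sum>k=1..j. w (j - k) *\<^sub>R opA e lam (v k)) = 0)"
  define V where "V m = (\<Sum>k. (C k m * (x \<bullet> e k)) *\<^sub>R e k)" for m
  have V: "V m \<bullet> e k = C k m * (x \<bullet> e k)" for m k
    unfolding V_def by (intro inner_suminf_basis summable_multiplier[of _ 1] Cb)
  have V0: "V 0 = x"
    by (rule basis_eqI) (simp add: V C0)
  have dom: "V (Suc n) \<in> domA e lam" for n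
  proof -
    obtain K where "\<And>k. \<bar>lam k * C k (Suc n)\<bar> \<le> K" using lam_C_bounded by blast
    then have "summable (\<lambda>k. (lam k * C k (Suc n) * (x \<bullet> e k))\<^sup>2)" by (rule summable_multiplier)
    then show ?thesis by (simp add: domA_def V mult.assoc)
  qed
  have eqV: "V (Suc n) - V n + dt *\<^sub>R (\<Sum>k=1..Suc n. w (Suc n - k) *\<^sub>R opA e lam (V k)) = 0" for n
    unfolding shift_sum
  proof (rule basis_eqI)
    fix k
    have "(V (Suc n) - V n + dt *\<^sub>R (\<Sum>i\<le>n. w (n - i) *\<^sub>R opA e lam (V (Suc i)))) \<bullet> e k
      = C k (Suc n) * (x \<bullet> e k) - C k n * (x \<bullet> e k)
        + dt * (\<Sum>i\<le>n. w (n - i) * (lam k * (C k (Suc i) * (x \<bullet> e k))))"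
      by (simp only: inner_add_left inner_diff_left inner_sum_left inner_scaleR_left V opA_inner[OF dom])
    also have "(\<Sum>i\<le>n. w (n - i) * (lam k * (C k (Suc i) * (x \<bullet> e k))))
      = lam k * (\<Sum>i\<le>n. C k (Suc i) * w (n - i)) * (x \<bullet> e k)"
      unfolding sum_distrib_left sum_distrib_right by (intro sum.cong) simp_all
    also have "C k (Suc n) * (x \<bullet> e k) - C k n * (x \<bullet> e k)
        + dt * (lam k * (\<Sum>i\<le>n. C k (Suc i) * w (n - i)) * (x \<bullet> e k))
      = (C k (Suc n) - C k n + dt * lam k * (\<Sum>i\<le>n. C k (Suc i) * w (n - i))) * (x \<bullet> e k)"
      by (simp only: left_diff_distrib distrib_right mult.assoc)
    finally have "(V (Suc n) - V n + dt *\<^sub>R (\<Sum>i\<le>n. w (n - i) *\<^sub>R opA e lam (V (Suc i)))) \<bullet> e k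
      = (C k (Suc n) - C k n + dt * lam k * (\<Sum>i\<le>n. C k (Suc i) * w (n - i))) * (x \<bullet> e k)" .
    then show "(V (Suc n) - V n + dt *\<^sub>R (\<Sum>i\<le>n. w (n - i) *\<^sub>R opA e lam (V (Suc i)))) \<bullet> e k = 0 \<bullet> e k"
      using C by simp
  qed
  have "?P V"
  proof (intro conjI allI impI)
    fix j :: nat assume "1 \<le> j"
    then obtain n where j: "j = Suc n" by (cases j) auto
    show "V j \<in> domA e lam" unfolding j by (rule dom)
    show "V j - V (j - 1) + dt *\<^sub>R (\<Sum>k=1..j. w (j - k) *\<^sub>R opA e lam (V k)) = 0"
      unfolding j using eqV[of n] by simp
  qed (rule V0)
  moreover have "v = V" if v: "?P v" for v
  proof
    fix m
    have vdom: "v (Suc n) \<in> domA e lam" for n using v by simp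
    have veq: "v (Suc n) - v n + dt *\<^sub>R (\<Sum>i\<le>n. w (n - i) *\<^sub>R opA e lam (v (Suc i))) = 0" for n
    proof -
      have "v (Suc n) - v (Suc n - 1) + dt *\<^sub>R (\<Sum>k=1..Suc n. w (Suc n - k) *\<^sub>R opA e lam (v k)) = 0"
        using v[THEN conjunct2, rule_format, of "Suc n"] by simp
      then show ?thesis unfolding shift_sum by simp
    qed
    have "v m \<bullet> e k = V m \<bullet> e k" for k
    proof (induction m rule: less_induct)
      case (less m)
      show ?case
      proof (cases m)
        case 0
        then show ?thesis using v V0 by simp
      next
        case (Suc n)
        \<comment> \<open>The difference of two solutions satisfies the homogeneous recursion. By
          induction only the newest term survives, with the positive factor
          \<open>1 + dt * w 0 * lam k\<close>.\<close>
        define d where "d i = v i \<bullet> e k - V i \<bullet> e k" for i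
        have d0: "d i = 0" if "i \<le> n" for i using less[of i] that Suc by (simp add: d_def)
        have "0 = (v (Suc n) - v n + dt *\<^sub>R (\<Sum>i\<le>n. w (n - i) *\<^sub>R opA e lam (v (Suc i)))) \<bullet> e k
          - (V (Suc n) - V n + dt *\<^sub>R (\<Sum>i\<le>n. w (n - i) *\<^sub>R opA e lam (V (Suc i)))) \<bullet> e k"
          using veq[of n] eqV[of n] unfolding shift_sum by simp
        also have "\<dots> = d (Suc n) - d n + dt * (\<Sum>i\<le>n. w (n - i) * (lam k * d (Suc i)))"
        proof -
          have "(\<Sum>i\<le>n. w (n - i) * (lam k * d (Suc i)))
            = (\<Sum>i\<le>n. w (n - i) * (lam k * (v (Suc i) \<bullet> e k))) - (\<Sum>i\<le>n. w (n - i) * (lam k * (V (Suc i) \<bullet> e k)))"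
            by (simp only: d_def right_diff_distrib sum_subtractf)
          then show ?thesis
            unfolding inner_add_left inner_diff_left inner_sum_left inner_scaleR_left
              opA_inner[OF dom] opA_inner[OF vdom]
            by (simp only: d_def right_diff_distrib)
        qed
        also have "(\<Sum>i\<le>n. w (n - i) * (lam k * d (Suc i))) = w 0 * (lam k * d (Suc n))"
          by (simp add: lessThan_Suc_atMost[symmetric] d0)
        finally have "d (Suc n) * (1 + dt * w 0 * lam k) = 0"
          using d0[of n] by (simp add: algebra_simps)
        moreover have "0 < 1 + dt * w 0 * lam k"
          using dt w0 lam[of k] by (simp add: add_pos_pos)
        ultimately have "d (Suc n) = 0" by auto
        then show ?thesis by (simp add: d_def Suc)
      qed
    qed
    then show "v m = V m" by (rule basis_eqI)
  qed
  ultimately have "(THE v. ?P v) = V"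
    by (rule the_equality)
  then show ?thesis
    unfolding Bop_def by (simp add: V)
qed

end

text \<open>Convexity on the open half line gives the tangent bound for \<open>y > 0\<close>. At
  \<open>y = 0\<close> the left side is \<open>(1 - p) * a powr p\<close>, which is at most
  \<open>0\<close>.\<close>

lemma powr_above_tangent:
  fixes a y p :: real
  assumes p: "1 \<le> p" and a: "0 < a" and y: "0 \<le> y"
  shows "a powr p + p * a powr (p - 1) * (y - a) \<le> y powr p"
proof (cases "y = 0")
  case True
  have "a powr (p - 1) * a = a powr p"
    using a powr_add[of a "p - 1" 1] by simp
  then have "a powr p + p * a powr (p - 1) * (y - a) = (1 - p) * a powr p"
    using True by (simp add: algebra_simps)
  also have "\<dots> \<le> 0" using p by (simp add: mult_nonpos_nonneg)
  finally show ?thesis using True by simp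
next
  case False
  have "p * a powr (p - 1) * (y - a) \<le> y powr p - a powr p"
  proof (rule convex_on_imp_above_tangent[where A="{0<..}"])
    show "convex_on {0<..} (\<lambda>x::real. x powr p)" by (rule powr_convex[OF p])
    show "((\<lambda>x. x powr p) has_real_derivative p * a powr (p - 1)) (at a within {0<..})"
      using a by (auto intro!: derivative_eq_intros)
  qed (use a y False in \<open>auto simp: interior_open\<close>)
  then show ?thesis by simp
qed

text \<open>The tangent bound at the mean \<open>a\<close> is integrated against \<open>g\<close>,
  where the linear term cancels. The tangent needs \<open>a > 0\<close>; for \<open>a = 0\<close>
  the left side is \<open>0\<close>.\<close>

lemma jensen_powr_density:
  fixes f g :: "real \<Rightarrow> real"
  assumes g: "integrable lborel g" "\<And>t. 0 \<le> g t" "(LINT t|lborel. g t) = 1"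
    and f: "\<And>t. 0 \<le> f t" "integrable lborel (\<lambda>t. g t * f t)" "integrable lborel (\<lambda>t. g t * f t powr p)"
    and p: "1 \<le> p"
  shows "(LINT t|lborel. g t * f t) powr p \<le> (LINT t|lborel. g t * f t powr p)"
proof -
  define a where "a = (LINT t|lborel. g t * f t)"
  have "0 \<le> a" unfolding a_def using g f by (intro integral_nonneg_AE) auto
  show ?thesis
  proof (cases "a = 0")
    case True
    have "0 \<le> (LINT t|lborel. g t * f t powr p)" using g by (intro integral_nonneg_AE) auto
    with True show ?thesis by (simp add: a_def)
  next
    case False
    with \<open>0 \<le> a\<close> have a: "0 < a" by simp
    let ?d = "p * a powr (p - 1)"
    have "a powr p = (LINT t|lborel. (a powr p - ?d * a) * g t + ?d * (g t * f t))"
      using g f by (simp add: a_def[symmetric])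
    also have "\<dots> \<le> (LINT t|lborel. g t * f t powr p)"
    proof (rule integral_mono)
      show "integrable lborel (\<lambda>t. (a powr p - ?d * a) * g t + ?d * (g t * f t))" using g f by simp
      fix t
      have "g t * (a powr p + ?d * (f t - a)) \<le> g t * f t powr p"
        using powr_above_tangent[OF p a f(1)[of t]] g(2)[of t] by (intro mult_left_mono)
      then show "(a powr p - ?d * a) * g t + ?d * (g t * f t) \<le> g t * f t powr p"
        by (simp add: algebra_simps)
    qed (rule f)
    finally show ?thesis by (simp add: a_def)
  qed
qed

section \<open>The estimates\<close>

text \<open>A partial sum of a nonnegative series whose total for \<open>t \<ge> 0\<close> is
  \<open>l\<close>. With \<open>l = 1 / dt\<close> this pays for the factor \<open>dt\<close> in the
  estimate.\<close>

lemma sum_erlang_density_le: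
  assumes l: "0 < l"
  shows "(\<Sum>j<n. erlang_density j l t) \<le> l"
proof (cases "0 \<le> t")
  case True
  have "(\<lambda>j. erlang_density j l t) sums l"
    using sums_erlang_density[OF True, of 1 l] by simp
  then show ?thesis
    using sum_le_suminf[of "\<lambda>j. erlang_density j l t" "{..<n}"] l by (simp add: sums_iff)
qed (use l in \<open>simp add: erlang_density_def\<close>)

theorem theorem4p1:
  fixes e :: "nat \<Rightarrow> 'a::{real_inner,complete_space}"
    and lam :: "nat \<Rightarrow> real"
    and b db :: "real \<Rightarrow> real"
    and s :: "nat \<Rightarrow> real \<Rightarrow> real"
    and w :: "nat \<Rightarrow> real"
    and dt :: real and x :: 'a
  assumes e_orthonormal: "\<And>i j. e i \<bullet> e j = (if i = j then 1 else 0)"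
    and e_complete: "\<And>v. (\<lambda>n. \<Sum>k<n. (v \<bullet> e k) *\<^sub>R e k) \<longlonglongrightarrow> v"
    and lam_pos: "0 < lam 0"
    and lam_mono: "mono lam"
    and lam_unbounded: "filterlim lam at_top sequentially"
    and b_L1loc: "\<And>T. 0 < T \<Longrightarrow> set_integrable lborel {0<..<T} b"
    and b_nonzero: "\<exists>t>0. b t \<noteq> 0"
    and b_nonneg: "\<And>t. 0 < t \<Longrightarrow> 0 \<le> b t"
    and b_noninc: "\<And>t u. 0 < t \<Longrightarrow> t \<le> u \<Longrightarrow> b u \<le> b t"
    and b_convex: "convex_on {0<..} b"
    and b_deriv: "\<And>t. 0 < t \<Longrightarrow> (b has_real_derivative db t) (at t)"
    and db_nonneg: "\<And>t. 0 < t \<Longrightarrow> 0 \<le> - db t"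
    and db_noninc: "\<And>t u. 0 < t \<Longrightarrow> t \<le> u \<Longrightarrow> - db u \<le> - db t"
    and db_convex: "convex_on {0<..} (\<lambda>t. - db t)"
    and b_lim: "(b \<longlongrightarrow> 0) at_top"
    and b_sector: "1 + 2 / pi * Sup ((\<lambda>z. \<bar>Arg (laplace b z)\<bar>) ` {z. 0 < Re z}) \<in> {1<..<2}"
    and s_cont: "\<And>k. continuous_on {0..} (s k)"
    and s_init: "\<And>k. s k 0 = 1"
    and s_eq: "\<And>k t. 0 \<le> t \<Longrightarrow>
        (s k has_real_derivative - (lam k * (LINT u:{0..t}|lborel. b (t - u) * s k u))) (at t within {0..})"
    and dt_pos: "0 < dt"
    and w_gen: "\<And>z::complex. norm z < 1 \<Longrightarrow>
        (\<lambda>k. complex_of_real (w k) * z ^ k) sums laplace b ((1 - z) / complex_of_real dt)"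
  shows "(\<forall>p::real. 1 \<le> p \<longrightarrow>
            (\<lambda>t. Sop e s t x) \<in> borel_measurable (restrict_space lborel {0<..}) \<longrightarrow>
            set_integrable lborel {0<..} (\<lambda>t. norm (Sop e s t x) powr p) \<longrightarrow>
            (\<forall>n\<ge>1. dt * (\<Sum>k=1..n. norm (Bop e lam w dt k x) powr p)
                     \<le> (LINT t:{0<..}|lborel. norm (Sop e s t x) powr p)))
       \<and> ((\<lambda>t. Sop e s t x) \<in> borel_measurable (restrict_space lborel {0<..}) \<longrightarrow>
            esssup (restrict_space lborel {0<..}) (\<lambda>t. ereal (norm (Sop e s t x))) < \<infinity> \<longrightarrow>
            (SUP k\<in>{1..}. ereal (norm (Bop e lam w dt k x)))
              \<le> esssup (restrict_space lborel {0<..}) (\<lambda>t. ereal (norm (Sop e s t x))))"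
proof -
  obtain t0 where t0: "0 < t0" "b t0 \<noteq> 0" using b_nonzero by auto
  interpret K: convex_kernel b
    by unfold_locales (use b_L1loc b_nonneg b_noninc b_convex in auto)
  have lamk: "0 < lam k" for k
    using lam_pos monoD[OF lam_mono, of 0 k] by simp
  have V: "scalar_volterra b (lam k) (s k)" for k
    by unfold_locales (use lamk s_cont s_init s_eq in auto)
  have w: "(\<lambda>k. w k * z ^ k) sums K.bhat ((1 - z) / dt)" if "\<bar>z\<bar> < 1" for z
  proof -
    have "(1 - complex_of_real z) / complex_of_real dt = complex_of_real ((1 - z) / dt)"
      by simp
    then have "(\<lambda>k. complex_of_real (w k * z ^ k)) sums complex_of_real (K.bhat ((1 - z) / dt))"
      using w_gen[of "complex_of_real z"] that K.laplace_of_real[of "(1 - z) / dt"] by simp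
    then show ?thesis by (simp only: sums_of_real_iff)
  qed
  \<comment> \<open>At \<open>z = 0\<close> the generating function reads
    \<open>w 0 = K.bhat (1 / dt)\<close>.\<close>
  have w0: "0 < w 0"
    using w[of 0] K.bhat_pos[OF _ t0, of "1 / dt"] dt_pos by simp
  define C where "C k m = scalar_volterra.gamma_avg (s k) dt m" for k m
  interpret implicit_scheme e lam w dt C
  proof
    show "e i \<bullet> e j = (if i = j then 1 else 0)" for i j by (rule e_orthonormal)
    show "(\<lambda>n. \<Sum>k<n. (v \<bullet> e k) *\<^sub>R e k) \<longlonglongrightarrow> v" for v by (rule e_complete)
    show "C k 0 = 1" for k by (simp add: C_def scalar_volterra.gamma_avg_def[OF V])
    show "\<bar>C k m\<bar> \<le> 1" for k m
      unfolding C_def by (rule scalar_volterra.gamma_avg_bounded[OF V dt_pos])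
    show "C k (Suc m) - C k m + dt * lam k * (\<Sum>i\<le>m. C k (Suc i) * w (m - i)) = 0" for k m
      unfolding C_def by (rule scalar_volterra.gamma_avg_recursion[OF V dt_pos w])
  qed (rule dt_pos lamk w0)+
  let ?l = "1 / dt"
  let ?B = "\<lambda>m. Bop e lam w dt m x"
  let ?S = "\<lambda>t. Sop e s t x"
  have l: "0 < ?l" using dt_pos by simp
  have S_inner: "?S t \<bullet> e k = s k t * (x \<bullet> e k)" if "0 \<le> t" for t k
    unfolding Sop_def
    by (intro inner_suminf_basis summable_multiplier[of _ 1] scalar_volterra.s_bounded[OF V that])
  have S_bounded: "norm (?S t) \<le> norm x" if "0 \<le> t" for t
  proof -
    have "(norm (?S t))\<^sup>2 \<le> (norm x)\<^sup>2"
    proof (rule sums_le[OF _ parseval parseval])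
      fix k
      have "(s k t)\<^sup>2 \<le> 1"
        using scalar_volterra.s_bounded[OF V that, of k] by (simp add: abs_square_le_1)
      then show "(?S t \<bullet> e k)\<^sup>2 \<le> (x \<bullet> e k)\<^sup>2"
        by (simp add: S_inner[OF that] power_mult_distrib mult_left_le_one_le)
    qed
    then show ?thesis by (simp add: abs_le_square_iff[symmetric])
  qed
  define f where "f t = indicator {0<..} t * norm (?S t)" for t
  have f_nonneg: "0 \<le> f t" for t by (simp add: f_def)
  have f_bounded: "f t \<le> norm x" for t
    using S_bounded[of t] by (auto simp: f_def indicator_def)
  \<comment> \<open>The majorant is left free: the density times \<open>f\<close> serves finite
    exponents, the density times a constant serves the essential supremum.\<close>
  have B_le: "norm (?B (Suc j)) \<le> (LINT t|lborel. \<psi> t)"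
    if \<psi>: "integrable lborel \<psi>" and le: "AE t in lborel. erlang_density j ?l t * f t \<le> \<psi> t" for j \<psi>
  proof (rule norm_le_integral[where F = "\<lambda>t. erlang_density j ?l t *\<^sub>R ?S t"])
    have F: "(erlang_density j ?l t *\<^sub>R ?S t) \<bullet> e k
        = (erlang_density j ?l t * scalar_volterra.s_ext (s k) t) * (x \<bullet> e k)" for t k
      by (cases "0 \<le> t") (simp_all add: S_inner scalar_volterra.s_ext_def[OF V] erlang_density_def)
    show "integrable lborel (\<lambda>t. (erlang_density j ?l t *\<^sub>R ?S t) \<bullet> e k)" for k
      unfolding F by (intro integrable_mult_left scalar_volterra.integrable_erlang_s_ext[OF V l])
    show "?B (Suc j) \<bullet> e k = (LINT t|lborel. (erlang_density j ?l t *\<^sub>R ?S t) \<bullet> e k)" for k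
      unfolding F Bop_inner by (simp add: C_def scalar_volterra.gamma_avg_def[OF V])
    have "AE t in lborel. t \<noteq> (0::real)" by (rule AE_lborel_singleton)
    with le show "AE t in lborel. norm (erlang_density j ?l t *\<^sub>R ?S t) \<le> \<psi> t"
    proof eventually_elim
      case (elim t)
      then show ?case
        using erlang_density_nonneg[of ?l j t] l
        by (cases "0 < t") (auto simp: f_def erlang_density_def)
    qed
  qed (rule \<psi>)
  have f_measurable: "f \<in> borel_measurable borel"
    if "(\<lambda>t. ?S t) \<in> borel_measurable (restrict_space lborel {0<..})"
  proof -
    have "(\<lambda>t. norm (?S t)) \<in> borel_measurable (restrict_space lborel {0<..})"
      by (rule measurable_compose[OF that]) (intro borel_measurable_continuous_onI continuous_intros)
    then show ?thesis
      by (subst (asm) borel_measurable_restrict_space_iff) (auto simp: f_def[abs_def])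
  qed
  have Lp: "dt * (\<Sum>k=1..n. norm (?B k) powr p) \<le> (LINT t:{0<..}|lborel. norm (?S t) powr p)"
    if p: "1 \<le> p" and meas: "(\<lambda>t. ?S t) \<in> borel_measurable (restrict_space lborel {0<..})"
      and int: "set_integrable lborel {0<..} (\<lambda>t. norm (?S t) powr p)" for p n
  proof -
    note [measurable] = f_measurable[OF meas]
    let ?e = "\<lambda>j. erlang_density j ?l"
    have fp: "f t powr p = indicator {0<..} t *\<^sub>R (norm (?S t) powr p)" for t
      by (auto simp: f_def indicator_def)
    have int_f: "integrable lborel (\<lambda>t. f t powr p)"
      using int unfolding set_integrable_def fp .
    have ei: "integrable lborel (?e j)" for j by (rule integral_erlang_density(1)[OF l])
    have eic: "integrable lborel (\<lambda>t. ?e j t * c)" for j c using ei by simp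
    have e0: "0 \<le> ?e j t" for j t using l by simp
    have ef: "integrable lborel (\<lambda>t. ?e j t * f t)" for j
    proof (rule Bochner_Integration.integrable_bound[OF eic[of _ "norm x"]])
      show "AE t in lborel. norm (?e j t * f t) \<le> norm (?e j t * norm x)"
        using f_nonneg f_bounded e0 by (intro AE_I2) (simp add: abs_mult mult_left_mono)
    qed measurable
    have efp: "integrable lborel (\<lambda>t. ?e j t * f t powr p)" for j
    proof (rule Bochner_Integration.integrable_bound[OF eic[of _ "norm x powr p"]])
      show "AE t in lborel. norm (?e j t * f t powr p) \<le> norm (?e j t * norm x powr p)"
        using f_nonneg f_bounded e0 p
        by (intro AE_I2) (simp add: abs_mult mult_left_mono powr_mono2)
    qed measurable
    have "norm (?B (Suc j)) powr p \<le> (LINT t|lborel. ?e j t * f t powr p)" for j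
    proof -
      have "norm (?B (Suc j)) powr p \<le> (LINT t|lborel. ?e j t * f t) powr p"
        using p by (intro powr_mono2 B_le[OF ef]) auto
      also have "\<dots> \<le> (LINT t|lborel. ?e j t * f t powr p)"
        by (rule jensen_powr_density[OF ei e0 integral_erlang_density(2)[OF l] f_nonneg ef efp p])
      finally show ?thesis .
    qed
    then have "(\<Sum>j<n. norm (?B (Suc j)) powr p) \<le> (\<Sum>j<n. LINT t|lborel. ?e j t * f t powr p)"
      by (rule sum_mono)
    also have "\<dots> = (LINT t|lborel. (\<Sum>j<n. ?e j t * f t powr p))"
      using efp by simp
    \<comment> \<open>The densities are summed pointwise under the integral, so the bound does not
      depend on \<open>n\<close>.\<close>
    also have "\<dots> \<le> (LINT t|lborel. ?l * f t powr p)"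
    proof (rule integral_mono)
      show "(\<Sum>j<n. ?e j t * f t powr p) \<le> ?l * f t powr p" for t
        using sum_erlang_density_le[OF l, of t n]
        by (simp only: sum_distrib_right[symmetric]) (intro mult_right_mono, auto)
    qed (use efp int_f in auto)
    also have "\<dots> = ?l * (LINT t|lborel. f t powr p)" by simp
    finally have "dt * (\<Sum>j<n. norm (?B (Suc j)) powr p) \<le> (LINT t|lborel. f t powr p)"
      using dt_pos by (simp add: field_simps)
    moreover have "(\<Sum>k=1..n. norm (?B k) powr p) = (\<Sum>j<n. norm (?B (Suc j)) powr p)"
      using sum.shift_bounds_nat_ivl[of "\<lambda>k. norm (?B k) powr p" 0 1 n]
      by (simp add: atLeast0LessThan atLeastLessThanSuc_atLeastAtMost)
    ultimately show ?thesis
      unfolding set_lebesgue_integral_def fp by simp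
  qed
  have Linf: "(SUP k\<in>{1..}. ereal (norm (?B k))) \<le> esssup (restrict_space lborel {0<..}) (\<lambda>t. ereal (norm (?S t)))"
    if fin: "esssup (restrict_space lborel {0<..}) (\<lambda>t. ereal (norm (?S t))) < \<infinity>"
  proof -
    let ?M = "esssup (restrict_space lborel {0<..}) (\<lambda>t. ereal (norm (?S t)))"
    \<comment> \<open>Any real upper bound of the extended-real \<open>?M\<close> is allowed, so
      that one estimate treats a finite \<open>?M\<close> and also excludes the value minus
      infinity.\<close>
    have bound: "norm (?B (Suc j)) \<le> r" if r: "?M \<le> ereal r" for j r
    proof -
      have "AE t in restrict_space lborel {0<..}. ereal (norm (?S t)) \<le> ?M"
        by (rule esssup_AE)
      then have "AE t in lborel. 0 < t \<longrightarrow> ereal (norm (?S t)) \<le> ?M"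
        by (simp add: AE_restrict_space_iff)
      then have "AE t in lborel. erlang_density j ?l t * f t \<le> erlang_density j ?l t * r"
        using AE_lborel_singleton[of "0::real"]
      proof eventually_elim
        case (elim t)
        show ?case
        proof (cases "0 < t")
          case True
          with elim r have "ereal (norm (?S t)) \<le> ereal r" by (blast intro: order_trans)
          then show ?thesis
            using True l by (intro mult_left_mono) (auto simp: f_def)
        qed (use elim in \<open>simp add: erlang_density_def\<close>)
      qed
      with B_le[of "\<lambda>t. erlang_density j ?l t * r" j] show ?thesis
        using integral_erlang_density[OF l, of j] by simp
    qed
    show ?thesis
    proof (cases ?M)
      case (real r)
      show ?thesis
      proof (rule SUP_least)
        fix k :: nat assume "k \<in> {1..}"
        then obtain j where "k = Suc j" by (cases k) auto
        then show "ereal (norm (?B k)) \<le> ?M" using bound[of r j] real by simp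
      qed
    next
      case MInf
      \<comment> \<open>If \<open>?M\<close> were minus infinity, \<open>r = -1\<close> would be an
        upper bound too, which no norm obeys.\<close>
      then have "norm (?B (Suc 0)) \<le> -1" by (intro bound) simp
      then show ?thesis using norm_ge_zero[of "?B (Suc 0)"] by linarith
    qed (use fin in simp)
  qed
  show ?thesis
    using Lp Linf by blast
qed

end
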